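(* Let $E\to M$ be a rank $n$ hermitian complex vector bundle over a smooth finite dimensional manifold, suppose $LFrE$ admits a reduction of its structure group to $L^0U(n)$, and let $j:L^0FrE\to LFrE$ be the embedding of the reduced bundle. Then $L^0FrE$ admits an $S^1$-action such that $j:L^0FrE\to LFrE$ is an $S^1$-equivariant map.
   Context: For a manifold $Y$, $LY=C^\infty(S^1,Y)$ is the free loop space with the Fréchet topology. $FrE\to M$ is the unitary frame bundle and $\tilde\pi:LFrE\to LM$ is a principal $LU(n)$-bundle with right action $(R_a\gamma)(\theta)=\gamma(\theta)a(\theta)$. $S^1$ acts on $LFrE$ by $(k_{\theta_0}\gamma)(\theta)=\gamma(\theta+\theta_0)$. $L^0U(n)$ is the connected component of the identity in $LU(n)$. The reduced bundle $\hat\pi:L^0FrE\to LM$ is a principal $L^0U(n)$-bundle with an embedding $j:L^0FrE\to LFrE$ satisfying $\hat\pi=\tilde\pi\circ j$ and $j\circ R_a=R_a\circ j$ for $a\in L^0U(n)$; it is chosen so that $j(L^0FrE)$ contains the constant loops in $FrE$. *)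

theory Defs
  imports "HOL-Analysis.Analysis"
begin

section \<open>Smooth maps between Euclidean spaces\<close>

text \<open>For an open set S this says that all partial derivatives up to order k exist and are
  continuous on S.\<close>

primrec ck_on :: "nat \<Rightarrow> 'a::euclidean_space set \<Rightarrow> ('a \<Rightarrow> 'b::real_normed_vector) \<Rightarrow> bool" where
  "ck_on 0 S f \<longleftrightarrow> continuous_on S f"
| "ck_on (Suc k) S f \<longleftrightarrow> (\<forall>x\<in>S. f differentiable (at x)) \<and>
     (\<forall>v. ck_on k S (\<lambda>x. frechet_derivative f (at x) v))"

text \<open>On an arbitrary set, a smooth map is one that locally extends to a smooth map on an open
  set; on open sets this is the usual notion.\<close>

definition smooth_on :: "'a::euclidean_space set \<Rightarrow> ('a \<Rightarrow> 'b::real_normed_vector) \<Rightarrow> bool" where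
  "smooth_on S f \<longleftrightarrow> (\<forall>x\<in>S. \<exists>U g. open U \<and> x \<in> U \<and> (\<forall>k. ck_on k U g) \<and> (\<forall>y\<in>S \<inter> U. g y = f y))"


section \<open>Finite-dimensional manifolds\<close>

type_synonym ('m, 'a) charts = "('m set \<times> ('m \<Rightarrow> 'a)) set"

text \<open>The model space V is a linear subspace of \<^typ>\<open>'a\<close>, so that every dimension, including 0,
  is covered.\<close>

definition smooth_manifold :: "'m topology \<Rightarrow> ('m, 'a::euclidean_space) charts \<Rightarrow> bool" where
  "smooth_manifold X A \<longleftrightarrow>
     Hausdorff_space X \<and> second_countable X \<and> \<Union>(fst ` A) = topspace X \<and>
     (\<exists>V. subspace V \<and>
        (\<forall>(U, \<phi>)\<in>A. openin X U \<and> openin (top_of_set V) (\<phi> ` U) \<and>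
           homeomorphic_map (subtopology X U) (top_of_set (\<phi> ` U)) \<phi>)) \<and>
     (\<forall>(U, \<phi>)\<in>A. \<forall>(U', \<phi>')\<in>A. smooth_on (\<phi> ` (U \<inter> U')) (\<phi>' \<circ> inv_into U \<phi>))"

definition smooth_function ::
    "('m, 'a::euclidean_space) charts \<Rightarrow> 'm set \<Rightarrow> ('m \<Rightarrow> 'b::real_normed_vector) \<Rightarrow> bool" where
  "smooth_function A D f \<longleftrightarrow> (\<forall>(U, \<phi>)\<in>A. smooth_on (\<phi> ` (U \<inter> D)) (f \<circ> inv_into U \<phi>))"


section \<open>Hermitian vector bundles and unitary frames\<close>

text \<open>Only the fibre operations, the metric and the local trivializations are recorded. A local
  trivialization over W is given by its second component, a map from the restriction of the bundle
  to W to \<open>\<complex>\<^sup>n\<close>; the topology and smooth structure of the total space are those determined by the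
  trivializations.\<close>

record ('m, 'e, 'n::finite) vbundle =
  bundle_total :: "'e set"
  bundle_proj :: "'e \<Rightarrow> 'm"
  fadd :: "'e \<Rightarrow> 'e \<Rightarrow> 'e"
  fscale :: "complex \<Rightarrow> 'e \<Rightarrow> 'e"
  herm :: "'e \<Rightarrow> 'e \<Rightarrow> complex"
  trivs :: "('m set \<times> ('e \<Rightarrow> complex^'n)) set"

definition fibre :: "('m, 'e, 'n::finite) vbundle \<Rightarrow> 'm \<Rightarrow> 'e set" where
  "fibre E x = {e \<in> bundle_total E. bundle_proj E e = x}"

text \<open>The vector space axioms on the fibres follow from the existence of the fibrewise linear
  bijections to \<open>\<complex>\<^sup>n\<close>.\<close>

definition complex_vector_bundle ::
    "'m topology \<Rightarrow> ('m, 'a::euclidean_space) charts \<Rightarrow> ('m, 'e, 'n::finite) vbundle \<Rightarrow> bool" where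
  "complex_vector_bundle X A E \<longleftrightarrow>
     bundle_proj E ` bundle_total E \<subseteq> topspace X \<and>
     \<Union>(fst ` trivs E) = topspace X \<and>
     (\<forall>(W, \<Phi>)\<in>trivs E. openin X W \<and>
        (\<forall>x\<in>W. bij_betw \<Phi> (fibre E x) UNIV \<and>
           (\<forall>u\<in>fibre E x. \<forall>v\<in>fibre E x. fadd E u v \<in> fibre E x \<and> \<Phi> (fadd E u v) = \<Phi> u + \<Phi> v) \<and>
           (\<forall>c. \<forall>u\<in>fibre E x. fscale E c u \<in> fibre E x \<and> \<Phi> (fscale E c u) = c *s \<Phi> u))) \<and>
     (\<forall>(W, \<Phi>)\<in>trivs E. \<forall>(W', \<Phi>')\<in>trivs E.
        \<exists>g :: 'm \<Rightarrow> complex^'n^'n. smooth_function A (W \<inter> W') g \<and>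
           (\<forall>x\<in>W \<inter> W'. \<forall>u\<in>fibre E x. \<Phi>' u = g x *v \<Phi> u))"

definition hermitian_bundle ::
    "'m topology \<Rightarrow> ('m, 'a::euclidean_space) charts \<Rightarrow> ('m, 'e, 'n::finite) vbundle \<Rightarrow> bool" where
  "hermitian_bundle X A E \<longleftrightarrow>
     complex_vector_bundle X A E \<and>
     (\<forall>x\<in>topspace X. \<forall>u\<in>fibre E x. \<forall>v\<in>fibre E x.
        (\<forall>w\<in>fibre E x. herm E (fadd E u v) w = herm E u w + herm E v w) \<and>
        (\<forall>c. herm E (fscale E c u) v = c * herm E u v) \<and>
        herm E v u = cnj (herm E u v)) \<and>
     (\<forall>x\<in>topspace X. \<forall>u\<in>fibre E x. u \<noteq> fscale E 0 u \<longrightarrow> Re (herm E u u) > 0) \<and>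
     (\<forall>(W, \<Phi>)\<in>trivs E. \<forall>v w. smooth_function A W
        (\<lambda>x. herm E (inv_into (fibre E x) \<Phi> v) (inv_into (fibre E x) \<Phi> w)))"

definition unitary_matrices :: "(complex^'n^'n::finite) set" where
  "unitary_matrices = {a. (\<chi> i j. cnj (a $ j $ i)) ** a = mat 1}"

text \<open>A unitary frame at x is a linear isometry from \<open>\<complex>\<^sup>n\<close> onto the fibre at x (the images of the
  standard basis vectors form the corresponding orthonormal basis); matrices act on frames from the
  right by precomposition.\<close>

definition frames :: "'m topology \<Rightarrow> ('m, 'e, 'n::finite) vbundle \<Rightarrow> (complex^'n \<Rightarrow> 'e) set" where
  "frames X E = {f. \<exists>x\<in>topspace X. bij_betw f UNIV (fibre E x) \<and>
     (\<forall>v w. f (v + w) = fadd E (f v) (f w)) \<and>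
     (\<forall>c v. f (c *s v) = fscale E c (f v)) \<and>
     (\<forall>v w. herm E (f v) (f w) = (\<Sum>i\<in>UNIV. v $ i * cnj (w $ i)))}"

definition frame_proj :: "('m, 'e, 'n::finite) vbundle \<Rightarrow> (complex^'n \<Rightarrow> 'e) \<Rightarrow> 'm" where
  "frame_proj E f = bundle_proj E (f 0)"

definition frame_act :: "(complex^'n \<Rightarrow> 'e) \<Rightarrow> complex^'n^'n::finite \<Rightarrow> (complex^'n \<Rightarrow> 'e)" where
  "frame_act f a = (\<lambda>v. f (a *v v))"

text \<open>The next two families consist of local embeddings into Euclidean spaces rather than of charts
  with open image. The unitary frame bundle is a submanifold of the bundle Hom(\<open>\<complex>\<^sup>n\<close>, E), whose
  local coordinates are a chart of the base together with the matrix of a linear map in a local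
  trivialization; similarly U(n) is a submanifold of the space of matrices. Smoothness of maps into
  these submanifolds, and the topology of their loop spaces, can be computed in such ambient
  coordinates.\<close>

definition frame_charts ::
    "'m topology \<Rightarrow> ('m, 'a::euclidean_space) charts \<Rightarrow> ('m, 'e, 'n::finite) vbundle \<Rightarrow>
     (complex^'n \<Rightarrow> 'e, 'a \<times> (complex^'n^'n)) charts" where
  "frame_charts X A E =
     {({f \<in> frames X E. frame_proj E f \<in> U \<inter> W}, \<lambda>f. (\<phi> (frame_proj E f), matrix (\<Phi> \<circ> f)))
      | U \<phi> W \<Phi>. (U, \<phi>) \<in> A \<and> (W, \<Phi>) \<in> trivs E}"

definition unitary_charts :: "(complex^'n^'n::finite, complex^'n^'n) charts" where
  "unitary_charts = {(unitary_matrices, \<lambda>a. a)}"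


section \<open>Smooth spaces\<close>

text \<open>Infinite-dimensional manifolds are treated as in convenient calculus: a smooth structure is
  recorded by the topology and the set of smooth curves defined on the real line, and a map is
  smooth if it sends smooth curves to smooth curves. Between Frechet manifolds this agrees with the
  usual notion of a smooth map.\<close>

record 'x smooth_space =
  stop :: "'x topology"
  scurves :: "(real \<Rightarrow> 'x) set"

abbreviation points :: "'x smooth_space \<Rightarrow> 'x set" where
  "points X \<equiv> topspace (stop X)"

definition prod_space :: "'x smooth_space \<Rightarrow> 'y smooth_space \<Rightarrow> ('x \<times> 'y) smooth_space" where
  "prod_space X Y = \<lparr>stop = prod_topology (stop X) (stop Y),
     scurves = {c. fst \<circ> c \<in> scurves X \<and> snd \<circ> c \<in> scurves Y}\<rparr>"

definition sub_space :: "'x smooth_space \<Rightarrow> 'x set \<Rightarrow> 'x smooth_space" where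
  "sub_space X S = \<lparr>stop = subtopology (stop X) S, scurves = {c \<in> scurves X. range c \<subseteq> S}\<rparr>"

definition smooth_map :: "'x smooth_space \<Rightarrow> 'y smooth_space \<Rightarrow> ('x \<Rightarrow> 'y) \<Rightarrow> bool" where
  "smooth_map X Y f \<longleftrightarrow>
     continuous_map (stop X) (stop Y) f \<and> (\<forall>c\<in>scurves X. f \<circ> c \<in> scurves Y)"

definition smooth_embedding :: "'x smooth_space \<Rightarrow> 'y smooth_space \<Rightarrow> ('x \<Rightarrow> 'y) \<Rightarrow> bool" where
  "smooth_embedding X Y f \<longleftrightarrow> embedding_map (stop X) (stop Y) f \<and>
     (\<forall>c. c \<in> scurves X \<longleftrightarrow> range c \<subseteq> points X \<and> f \<circ> c \<in> scurves Y)"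

definition diffeomorphism :: "'x smooth_space \<Rightarrow> 'y smooth_space \<Rightarrow> ('x \<Rightarrow> 'y) \<Rightarrow> bool" where
  "diffeomorphism X Y f \<longleftrightarrow> smooth_embedding X Y f \<and> f ` points X = points Y"

text \<open>Smooth principal bundle with structure group G (with multiplication \<open>mul\<close> and unit \<open>e\<close>)
  acting from the right, locally trivial by equivariant trivializations.\<close>

definition principal_bundle ::
    "'g smooth_space \<Rightarrow> ('g \<Rightarrow> 'g \<Rightarrow> 'g) \<Rightarrow> 'g \<Rightarrow> 'p smooth_space \<Rightarrow> 'b smooth_space \<Rightarrow>
     ('p \<Rightarrow> 'b) \<Rightarrow> ('p \<Rightarrow> 'g \<Rightarrow> 'p) \<Rightarrow> bool" where
  "principal_bundle G mul e P B pr act \<longleftrightarrow>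
     smooth_map P B pr \<and>
     smooth_map (prod_space P G) P (\<lambda>(p, a). act p a) \<and>
     (\<forall>p\<in>points P. act p e = p) \<and>
     (\<forall>p\<in>points P. \<forall>a\<in>points G. \<forall>b\<in>points G. act (act p a) b = act p (mul a b)) \<and>
     (\<forall>p\<in>points P. \<forall>a\<in>points G. pr (act p a) = pr p) \<and>
     (\<forall>x\<in>points B. \<exists>V \<tau>. openin (stop B) V \<and> x \<in> V \<and>
        diffeomorphism (sub_space P {p \<in> points P. pr p \<in> V}) (prod_space (sub_space B V) G)
          (\<lambda>p. (pr p, \<tau> p)) \<and>
        (\<forall>p\<in>points P. \<forall>a\<in>points G. pr p \<in> V \<longrightarrow> \<tau> (act p a) = mul (\<tau> p) a))"


section \<open>Loop spaces\<close>

text \<open>The circle is \<open>\<real> / 2\<pi>\<int>\<close>; a loop is a smooth \<open>2\<pi>\<close>-periodic map on the real line.\<close>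

definition smooth_into :: "('y, 'b::euclidean_space) charts \<Rightarrow> ('x::euclidean_space \<Rightarrow> 'y) \<Rightarrow> bool" where
  "smooth_into A c \<longleftrightarrow> range c \<subseteq> \<Union>(fst ` A) \<and>
     (\<forall>(U, \<psi>)\<in>A. open (c -` U) \<and> smooth_on (c -` U) (\<psi> \<circ> c))"

definition loops :: "('y, 'b::euclidean_space) charts \<Rightarrow> (real \<Rightarrow> 'y) set" where
  "loops A = {\<gamma>. smooth_into A \<gamma> \<and> (\<forall>\<theta>. \<gamma> (\<theta> + 2 * pi) = \<gamma> \<theta>)}"

definition curve_deriv :: "nat \<Rightarrow> (real \<Rightarrow> 'b::real_normed_vector) \<Rightarrow> real \<Rightarrow> 'b" where
  "curve_deriv k = (\<lambda>f t. vector_derivative f (at t)) ^^ k"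

definition loop_nbhd ::
    "('y, 'b::euclidean_space) charts \<Rightarrow> (real \<Rightarrow> 'y) \<Rightarrow> 'y set \<Rightarrow> ('y \<Rightarrow> 'b) \<Rightarrow> real \<Rightarrow> real \<Rightarrow>
     nat \<Rightarrow> real \<Rightarrow> (real \<Rightarrow> 'y) set" where
  "loop_nbhd A \<gamma> U \<psi> a b r \<epsilon> = {\<delta> \<in> loops A. \<delta> ` {a..b} \<subseteq> U \<and>
     (\<forall>k\<le>r. \<forall>\<theta>\<in>{a..b}. norm (curve_deriv k (\<psi> \<circ> \<delta>) \<theta> - curve_deriv k (\<psi> \<circ> \<gamma>) \<theta>) < \<epsilon>)}"

text \<open>The Frechet topology: uniform convergence in charts of all derivatives, that is, the
  compact-open \<open>C\<^sup>\<infinity>\<close> topology.\<close>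

definition loop_topology :: "('y, 'b::euclidean_space) charts \<Rightarrow> (real \<Rightarrow> 'y) topology" where
  "loop_topology A = topology_generated_by
     {loop_nbhd A \<gamma> U \<psi> a b r \<epsilon> | \<gamma> U \<psi> a b r \<epsilon>.
        \<gamma> \<in> loops A \<and> (U, \<psi>) \<in> A \<and> a \<le> b \<and> \<gamma> ` {a..b} \<subseteq> U \<and> \<epsilon> > 0}"

text \<open>By the exponential law, a curve in the loop space is smooth iff its adjoint, a map of two
  variables, is smooth.\<close>

definition loop_space :: "('y, 'b::euclidean_space) charts \<Rightarrow> (real \<Rightarrow> 'y) smooth_space" where
  "loop_space A = \<lparr>stop = loop_topology A,
     scurves = {c. range c \<subseteq> loops A \<and> smooth_into A (\<lambda>(s, \<theta>). c s \<theta>)}\<rparr>"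

definition loop_rotate :: "real \<Rightarrow> (real \<Rightarrow> 'y) \<Rightarrow> (real \<Rightarrow> 'y)" where
  "loop_rotate \<theta>\<^sub>0 \<gamma> = (\<lambda>\<theta>. \<gamma> (\<theta> + \<theta>\<^sub>0))"


section \<open>The loop group, the loop frame bundle and reductions to the identity component\<close>

definition LU :: "(real \<Rightarrow> complex^'n^'n::finite) smooth_space" where
  "LU = loop_space unitary_charts"

definition LU_mult :: "(real \<Rightarrow> complex^'n^'n::finite) \<Rightarrow> (real \<Rightarrow> complex^'n^'n) \<Rightarrow> (real \<Rightarrow> complex^'n^'n)" where
  "LU_mult a b = (\<lambda>\<theta>. a \<theta> ** b \<theta>)"

definition LU_one :: "real \<Rightarrow> complex^'n^'n::finite" where
  "LU_one = (\<lambda>\<theta>. mat 1)"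

definition L0U :: "(real \<Rightarrow> complex^'n^'n::finite) smooth_space" where
  "L0U = sub_space LU (connected_component_of_set (stop LU) LU_one)"

definition LFr ::
    "'m topology \<Rightarrow> ('m, 'a::euclidean_space) charts \<Rightarrow> ('m, 'e, 'n::finite) vbundle \<Rightarrow>
     (real \<Rightarrow> complex^'n \<Rightarrow> 'e) smooth_space" where
  "LFr X A E = loop_space (frame_charts X A E)"

definition LFr_proj ::
    "('m, 'e, 'n::finite) vbundle \<Rightarrow> (real \<Rightarrow> complex^'n \<Rightarrow> 'e) \<Rightarrow> (real \<Rightarrow> 'm)" where
  "LFr_proj E \<gamma> = (\<lambda>\<theta>. frame_proj E (\<gamma> \<theta>))"

definition LFr_act ::
    "(real \<Rightarrow> complex^'n \<Rightarrow> 'e) \<Rightarrow> (real \<Rightarrow> complex^'n^'n::finite) \<Rightarrow> (real \<Rightarrow> complex^'n \<Rightarrow> 'e)" where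
  "LFr_act \<gamma> a = (\<lambda>\<theta>. frame_act (\<gamma> \<theta>) (a \<theta>))"

text \<open>The last condition is the normalization that the image of the reduced bundle contains the
  constant loops.\<close>

definition L0_reduction ::
    "'m topology \<Rightarrow> ('m, 'a::euclidean_space) charts \<Rightarrow> ('m, 'e, 'n::finite) vbundle \<Rightarrow>
     'p smooth_space \<Rightarrow> ('p \<Rightarrow> real \<Rightarrow> 'm) \<Rightarrow> ('p \<Rightarrow> (real \<Rightarrow> complex^'n^'n) \<Rightarrow> 'p) \<Rightarrow>
     ('p \<Rightarrow> real \<Rightarrow> complex^'n \<Rightarrow> 'e) \<Rightarrow> bool" where
  "L0_reduction X A E P pr act j \<longleftrightarrow>
     principal_bundle L0U LU_mult LU_one P (loop_space A) pr act \<and>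
     smooth_embedding P (LFr X A E) j \<and>
     (\<forall>p\<in>points P. pr p = LFr_proj E (j p)) \<and>
     (\<forall>p\<in>points P. \<forall>a\<in>points L0U. j (act p a) = LFr_act (j p) a) \<and>
     (\<forall>f\<in>frames X E. (\<lambda>\<theta>. f) \<in> j ` points P)"


section \<open>Circle actions\<close>

definition circle :: "complex smooth_space" where
  "circle = \<lparr>stop = top_of_set (sphere 0 1),
     scurves = {c. range c \<subseteq> sphere 0 1 \<and> smooth_on UNIV c}\<rparr>"

definition circle_action :: "'p smooth_space \<Rightarrow> (complex \<Rightarrow> 'p \<Rightarrow> 'p) \<Rightarrow> bool" where
  "circle_action P \<rho> \<longleftrightarrow>
     smooth_map (prod_space circle P) P (\<lambda>(z, p). \<rho> z p) \<and>
     (\<forall>p\<in>points P. \<rho> 1 p = p) \<and>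
     (\<forall>z\<in>points circle. \<forall>w\<in>points circle. \<forall>p\<in>points P. \<rho> (z * w) p = \<rho> z (\<rho> w p))"

end

(* The set of rotation parameters t for which the rotation of j(p) lies in the image of j contains 0
   and is locally constant, hence is everything. Locally, lift the rotated base loops to a smooth
   curve in the reduced bundle through a given point, using a local trivialization. The rotations of
   j(p) differ from the image of this lift by a smooth curve of loops in U(n) that passes through the
   unit loop and so stays in the identity component, whose action preserves the image of j.
   The transported action is smooth because j is an embedding and rotation of loops is jointly
   continuous and smooth, once curves in the circle are lifted to smooth curves of angles. *)
theory Submission
  imports Defs
begin

text \<open>A lift exists only over a trivializing set, so the argument is local; the local
  statement is symmetric in two rotation parameters, which makes the complement of the good set open
  as well. The lift starts from the base because the rotated base loops form a smooth curve
  outright, while nothing is known in advance about rotated loops in the reduced bundle. Smoothness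
  of the difference is obtained without inverting frames: unitary frames are orthonormal, so the
  matrix relating two of them has hermitian products as entries, and these are smooth in
  trivializations. That a smooth curve of loops stays in one component rests on its continuity for
  uniform convergence of all derivatives, where compactness of intervals enters. Finally, the action
  is parametrized by the circle and not by angles. Rotation depends on \<open>cis t\<close> alone by
  periodicity, but \<open>Arg\<close> jumps; continuity therefore uses local inverses of
  \<open>cis\<close>, and smoothness integrates the angular velocity.\<close>

section \<open>Calculus of smooth maps\<close>

lemma ck_on_cong:
  assumes "open S" "\<And>x. x \<in> S \<Longrightarrow> f x = g x" "ck_on k S f"
  shows "ck_on k S g"
  using assms(2,3)
proof (induction k arbitrary: f g)
  case 0
  then show ?case using continuous_on_eq[of S f g] by simp
next
  case (Suc k)
  have D: "(g has_derivative frechet_derivative f (at x)) (at x)" if "x \<in> S" for x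
  proof (rule has_derivative_transform_within_open[OF _ assms(1) that])
    show "(f has_derivative frechet_derivative f (at x)) (at x)"
      using Suc.prems(2) that by (simp add: frechet_derivative_works)
  qed (use Suc.prems(1) in auto)
  have eq: "frechet_derivative f (at x) = frechet_derivative g (at x)" if "x \<in> S" for x
    using frechet_derivative_at[OF D[OF that]] .
  have "ck_on k S (\<lambda>x. frechet_derivative g (at x) v)" for v
    by (rule Suc.IH[where f = "\<lambda>x. frechet_derivative f (at x) v"]) (use eq Suc.prems(2) in auto)
  then show ?case
    using D by (auto simp: differentiable_def)
qed

text \<open>\<open>ck_on\<close> is phrased with the choice operator
  \<open>frechet_derivative\<close>. Uniqueness of derivatives lets any explicit family
  \<open>D\<close> replace it, so the closure rules below reduce to rules for
  \<open>has_derivative\<close>.\<close>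

lemma ck_on_SucI:
  assumes "open S" "\<And>x. x \<in> S \<Longrightarrow> (f has_derivative D x) (at x)" "\<And>v. ck_on k S (\<lambda>x. D x v)"
  shows "ck_on (Suc k) S f"
proof -
  have "D x = frechet_derivative f (at x)" if "x \<in> S" for x
    using frechet_derivative_at[OF assms(2)[OF that]] .
  then have "ck_on k S (\<lambda>x. frechet_derivative f (at x) v)" for v
    by (intro ck_on_cong[OF assms(1) _ assms(3)[of v]]) auto
  then show ?thesis
    using assms(2) by (auto simp: differentiable_def)
qed

lemma ck_on_Suc_has_derivative:
  "ck_on (Suc k) S f \<Longrightarrow> x \<in> S \<Longrightarrow> (f has_derivative frechet_derivative f (at x)) (at x)"
  by (simp add: frechet_derivative_works)

lemma ck_on_imp_continuous_on: "ck_on k S f \<Longrightarrow> continuous_on S f"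
  by (cases k) (auto intro!: continuous_at_imp_continuous_on differentiable_imp_continuous_within)

lemma ck_on_SucD: "ck_on (Suc k) S f \<Longrightarrow> ck_on k S f"
proof (induction k arbitrary: f)
  case 0
  then show ?case using ck_on_imp_continuous_on by fastforce
next
  case (Suc k)
  then show ?case by simp
qed

lemma ck_on_subset: "ck_on k S f \<Longrightarrow> T \<subseteq> S \<Longrightarrow> ck_on k T f"
  by (induction k arbitrary: f) (auto intro: continuous_on_subset)

lemma ck_on_locally:
  assumes "\<And>x. x \<in> S \<Longrightarrow> \<exists>U. open U \<and> x \<in> U \<and> ck_on k U f"
  shows "ck_on k S f"
  using assms
proof (induction k arbitrary: f)
  case 0
  have "continuous (at x) f" if "x \<in> S" for x
    using 0[OF that] by (auto simp: continuous_on_eq_continuous_at)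
  then show ?case by (auto intro: continuous_at_imp_continuous_on)
next
  case (Suc k)
  have "f differentiable (at x)" if "x \<in> S" for x
    using Suc.prems[OF that] by auto
  moreover have "ck_on k S (\<lambda>x. frechet_derivative f (at x) v)" for v
    by (rule Suc.IH) (use Suc.prems in fastforce)
  ultimately show ?case by simp
qed

lemma ck_on_const:
  assumes "open S"
  shows "ck_on k S (\<lambda>x. c)"
proof (induction k arbitrary: c)
  case 0
  show ?case by simp
next
  case (Suc k)
  show ?case
    by (rule ck_on_SucI[OF assms has_derivative_const Suc.IH])
qed

lemma ck_on_bounded_linear:
  assumes "bounded_linear L" "open S" "ck_on k S f"
  shows "ck_on k S (\<lambda>x. L (f x))"
  using assms(3)
proof (induction k arbitrary: f)
  case 0
  then show ?case
    using assms(1) by (simp add: bounded_linear.continuous_on)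
next
  case (Suc k)
  show ?case
  proof (rule ck_on_SucI[OF assms(2)])
    show "((\<lambda>x. L (f x)) has_derivative (\<lambda>v. L (frechet_derivative f (at x) v))) (at x)"
      if "x \<in> S" for x
      using bounded_linear.has_derivative[OF assms(1) ck_on_Suc_has_derivative[OF Suc.prems that]] .
  qed (use Suc in auto)
qed

lemma ck_on_add:
  assumes "open S" "ck_on k S f" "ck_on k S g"
  shows "ck_on k S (\<lambda>x. f x + g x)"
  using assms(2,3)
proof (induction k arbitrary: f g)
  case 0
  then show ?case by (auto intro: continuous_intros)
next
  case (Suc k)
  show ?case
  proof (rule ck_on_SucI[OF assms(1)])
    show "((\<lambda>x. f x + g x) has_derivative
        (\<lambda>v. frechet_derivative f (at x) v + frechet_derivative g (at x) v)) (at x)"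
      if "x \<in> S" for x
      using that Suc.prems by (intro has_derivative_add ck_on_Suc_has_derivative)
  qed (use Suc in auto)
qed

lemma ck_on_bilinear:
  assumes "bounded_bilinear B" "open S" "ck_on k S f" "ck_on k S g"
  shows "ck_on k S (\<lambda>x. B (f x) (g x))"
  using assms(3,4)
proof (induction k arbitrary: f g)
  case 0
  then show ?case
    using bounded_bilinear.continuous_on[OF assms(1)] by auto
next
  case (Suc k)
  show ?case
  proof (rule ck_on_SucI[OF assms(2)])
    show "((\<lambda>x. B (f x) (g x)) has_derivative (\<lambda>v. B (f x) (frechet_derivative g (at x) v)
        + B (frechet_derivative f (at x) v) (g x))) (at x)" if "x \<in> S" for x
      using that Suc.prems
      by (intro bounded_bilinear.FDERIV[OF assms(1)] ck_on_Suc_has_derivative)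
    \<comment> \<open>The product rule pairs a factor of class \<open>Suc k\<close> with a
      derivative of class \<open>k\<close>; the former is demoted so that the induction hypothesis
      applies.\<close>
    show "ck_on k S (\<lambda>x. B (f x) (frechet_derivative g (at x) v)
        + B (frechet_derivative f (at x) v) (g x))" for v
      using Suc.prems by (intro ck_on_add[OF assms(2)] Suc.IH ck_on_SucD[of k S f]
          ck_on_SucD[of k S g]) auto
  qed
qed

lemma ck_on_sum:
  assumes "open S" "\<And>i. i \<in> I \<Longrightarrow> ck_on k S (f i)"
  shows "ck_on k S (\<lambda>x. \<Sum>i\<in>I. f i x)"
  using assms(2)
  by (induction I rule: infinite_finite_induct) (auto intro: ck_on_const ck_on_add assms(1))

text \<open>The chain rule evaluates the derivative of \<open>g\<close> in a direction that moves
  with \<open>x\<close>, while \<open>ck_on\<close> controls only fixed directions. Expanding the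
  direction in \<open>Basis\<close> leaves scalar functions times derivatives of \<open>g\<close> in
  fixed directions composed with \<open>f\<close>, and the latter fall under the induction
  hypothesis.\<close>

lemma ck_on_compose:
  fixes f :: "'a::euclidean_space \<Rightarrow> 'b::euclidean_space" and g :: "'b \<Rightarrow> 'c::real_normed_vector"
  assumes "open S" "open T" "f ` S \<subseteq> T" "ck_on k S f" "ck_on k T g"
  shows "ck_on k S (\<lambda>x. g (f x))"
  using assms(4,5)
proof (induction k arbitrary: g)
  case 0
  then show ?case
    using assms(3) continuous_on_compose2[of T g S f] by simp
next
  case (Suc k)
  let ?D = "\<lambda>x v. \<Sum>b\<in>Basis. (frechet_derivative f (at x) v \<bullet> b) *\<^sub>R frechet_derivative g (at (f x)) b"
  show ?case
  proof (rule ck_on_SucI[OF assms(1)])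
    fix x assume x: "x \<in> S"
    have g: "(g has_derivative frechet_derivative g (at (f x))) (at (f x))"
      using x assms(3) by (intro ck_on_Suc_has_derivative[OF Suc.prems(2)]) auto
    interpret linear "frechet_derivative g (at (f x))"
      using g has_derivative_linear by blast
    have "frechet_derivative g (at (f x)) w
        = (\<Sum>b\<in>Basis. (w \<bullet> b) *\<^sub>R frechet_derivative g (at (f x)) b)" for w
      by (subst euclidean_representation[symmetric, of w]) (simp only: sum scale)
    then have "?D x = (\<lambda>v. frechet_derivative g (at (f x)) (frechet_derivative f (at x) v))"
      by (intro ext) (rule sym)
    then show "((\<lambda>x. g (f x)) has_derivative ?D x) (at x)"
      using has_derivative_compose[OF ck_on_Suc_has_derivative[OF Suc.prems(1) x] g] by simp
  next
    fix v
    have "ck_on k S (\<lambda>x. frechet_derivative f (at x) v \<bullet> b)" for b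
      using Suc.prems(1) by (intro ck_on_bounded_linear[OF bounded_linear_inner_left] assms(1)) auto
    moreover have "ck_on k S (\<lambda>x. frechet_derivative g (at (f x)) b)" for b
      using Suc.prems by (intro Suc.IH ck_on_SucD[of k S f]) auto
    ultimately show "ck_on k S (\<lambda>x. ?D x v)"
      by (intro ck_on_sum ck_on_bilinear[OF bounded_bilinear_scaleR] assms(1))
  qed
qed

lemma ck_on_ident:
  assumes "open S"
  shows "ck_on k S (\<lambda>x. x)"
proof -
  have "ck_on (Suc k) S (\<lambda>x. x)"
    by (rule ck_on_SucI[OF assms has_derivative_ident ck_on_const[OF assms]])
  then show ?thesis
    by (rule ck_on_SucD)
qed

text \<open>Differentiation preserves the span of sin and cos, so the induction runs over all
  coefficients at once. Later this makes the oscillating rotation parameter smooth.\<close>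

lemma ck_on_sin_cos: "ck_on k UNIV (\<lambda>s::real. A * sin s + B * cos s :: real)"
proof (induction k arbitrary: A B)
  case 0
  then show ?case by (auto intro!: continuous_intros)
next
  case (Suc k)
  show ?case
  proof (rule ck_on_SucI[where D = "\<lambda>s v. (- B * v) * sin s + (A * v) * cos s"])
    show "((\<lambda>s. A * sin s + B * cos s) has_derivative
        (\<lambda>v. (- B * v) * sin s + (A * v) * cos s)) (at s)" for s
      by (auto intro!: derivative_eq_intros simp: algebra_simps)
    show "ck_on k UNIV (\<lambda>s. (- B * v) * sin s + (A * v) * cos s)" for v
      by (rule Suc.IH)
  qed simp
qed

section \<open>Smooth maps on arbitrary sets\<close>

lemma smooth_onE:
  assumes "smooth_on S f" "x \<in> S"
  obtains U g where "open U" "x \<in> U" "\<And>k. ck_on k U g" "\<And>y. y \<in> S \<Longrightarrow> y \<in> U \<Longrightarrow> g y = f y"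
proof -
  have "\<exists>U g. open U \<and> x \<in> U \<and> (\<forall>k. ck_on k U g) \<and> (\<forall>y\<in>S \<inter> U. g y = f y)"
    using assms unfolding smooth_on_def by (rule bspec)
  then obtain U g where "open U" "x \<in> U" "\<forall>k. ck_on k U g" "\<forall>y\<in>S \<inter> U. g y = f y"
    by (elim exE conjE)
  then show thesis
    by (intro that[of U g]) simp_all
qed

lemma smooth_onI:
  assumes "\<And>x. x \<in> S \<Longrightarrow> \<exists>U g. open U \<and> x \<in> U \<and> (\<forall>k. ck_on k U g) \<and> (\<forall>y\<in>S \<inter> U. g y = f y)"
  shows "smooth_on S f"
  using assms unfolding smooth_on_def by (rule ballI)

lemma smooth_on_openI: "open S \<Longrightarrow> (\<And>k. ck_on k S f) \<Longrightarrow> smooth_on S f"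
  by (rule smooth_onI, rule exI[of _ S], rule exI[of _ f]) simp

lemma smooth_on_openD:
  assumes "open S" "smooth_on S f"
  shows "ck_on k S f"
proof (rule ck_on_locally)
  fix x assume "x \<in> S"
  then obtain U g where U: "open U" "x \<in> U" "ck_on k U g" "\<And>y. y \<in> S \<Longrightarrow> y \<in> U \<Longrightarrow> g y = f y"
    by (rule smooth_onE[OF assms(2)]) (rule that)
  have "ck_on k (S \<inter> U) f"
    by (rule ck_on_cong[OF open_Int[OF assms(1) U(1)] _ ck_on_subset[OF U(3)]]) (use U(4) in auto)
  then show "\<exists>U. open U \<and> x \<in> U \<and> ck_on k U f"
    using U(1,2) assms(1) \<open>x \<in> S\<close> by (intro exI[of _ "S \<inter> U"] conjI open_Int IntI)
qed

lemma smooth_on_cong: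
  assumes "smooth_on S f" "\<And>x. x \<in> S \<Longrightarrow> f x = g x"
  shows "smooth_on S g"
proof (rule smooth_onI)
  fix x assume "x \<in> S"
  then obtain U h where "open U" "x \<in> U" "\<And>k. ck_on k U h" "\<And>y. y \<in> S \<Longrightarrow> y \<in> U \<Longrightarrow> h y = f y"
    by (rule smooth_onE[OF assms(1)]) (rule that)
  then show "\<exists>U h. open U \<and> x \<in> U \<and> (\<forall>k. ck_on k U h) \<and> (\<forall>y\<in>S \<inter> U. h y = g y)"
    using assms(2) by (intro exI[of _ U] exI[of _ h]) simp
qed

lemma smooth_on_subset:
  assumes "smooth_on S f" "T \<subseteq> S"
  shows "smooth_on T f"
proof (rule smooth_onI)
  fix x assume "x \<in> T"
  with assms(2) have "x \<in> S" by blast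
  then obtain U h where "open U" "x \<in> U" "\<And>k. ck_on k U h" "\<And>y. y \<in> S \<Longrightarrow> y \<in> U \<Longrightarrow> h y = f y"
    by (rule smooth_onE[OF assms(1)]) (rule that)
  then show "\<exists>U h. open U \<and> x \<in> U \<and> (\<forall>k. ck_on k U h) \<and> (\<forall>y\<in>T \<inter> U. h y = f y)"
    using assms(2) by (intro exI[of _ U] exI[of _ h]) (simp add: subset_iff)
qed

lemma smooth_on_locally:
  assumes "\<And>x. x \<in> S \<Longrightarrow> \<exists>U. open U \<and> x \<in> U \<and> smooth_on (S \<inter> U) f"
  shows "smooth_on S f"
proof (rule smooth_onI)
  fix x assume x: "x \<in> S"
  then obtain U where U: "open U" "x \<in> U" "smooth_on (S \<inter> U) f"
    using assms by blast
  then obtain W g where W: "open W" "x \<in> W" "\<And>k. ck_on k W g" "\<And>y. y \<in> S \<inter> U \<Longrightarrow> y \<in> W \<Longrightarrow> g y = f y"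
    using x by (elim smooth_onE[where x = x]) auto
  then show "\<exists>U g. open U \<and> x \<in> U \<and> (\<forall>k. ck_on k U g) \<and> (\<forall>y\<in>S \<inter> U. g y = f y)"
    using U ck_on_subset[OF W(3), of "U \<inter> W"] by (intro exI[of _ "U \<inter> W"] exI[of _ g]) auto
qed

lemma smooth_on_imp_continuous_on:
  assumes "smooth_on S f"
  shows "continuous_on S f"
  unfolding continuous_on_eq_continuous_within
proof
  fix x assume x: "x \<in> S"
  then obtain U g where U: "open U" "x \<in> U" "\<And>k. ck_on k U g" "\<And>y. y \<in> S \<Longrightarrow> y \<in> U \<Longrightarrow> g y = f y"
    by (rule smooth_onE[OF assms]) (rule that)
  then have "continuous (at x) g"
    using ck_on_imp_continuous_on continuous_on_eq_continuous_at by blast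
  then have "continuous (at x within S) g"
    by (rule continuous_at_imp_continuous_at_within)
  moreover have "\<forall>\<^sub>F y in at x within S. g y = f y"
    using U by (auto simp: eventually_at_topological)
  \<comment> \<open>The filter \<open>at x within S\<close> does not see \<open>x\<close> itself, so
    the limit value is matched separately.\<close>
  moreover have "g x = f x"
    using x U by auto
  ultimately show "continuous (at x within S) f"
    unfolding continuous_within by (auto intro: Lim_transform_eventually)
qed

lemma smooth_on_const: "smooth_on S (\<lambda>x. c)"
  by (rule smooth_on_subset[OF smooth_on_openI[OF open_UNIV ck_on_const[OF open_UNIV]]]) simp

lemma smooth_on_ident: "smooth_on S (\<lambda>x. x)"
  by (rule smooth_on_subset[OF smooth_on_openI[OF open_UNIV ck_on_ident[OF open_UNIV]]]) simp

lemma smooth_on_bounded_linear: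
  assumes "bounded_linear L" "smooth_on S f"
  shows "smooth_on S (\<lambda>x. L (f x))"
proof (rule smooth_onI)
  fix x assume "x \<in> S"
  then obtain U g where U: "open U" "x \<in> U" "\<And>k. ck_on k U g" "\<And>y. y \<in> S \<Longrightarrow> y \<in> U \<Longrightarrow> g y = f y"
    by (rule smooth_onE[OF assms(2)]) (rule that)
  then show "\<exists>U g. open U \<and> x \<in> U \<and> (\<forall>k. ck_on k U g) \<and> (\<forall>y\<in>S \<inter> U. g y = L (f y))"
    by (intro exI[of _ U] exI[of _ "\<lambda>x. L (g x)"]) (auto intro: ck_on_bounded_linear assms(1))
qed

text \<open>Local extensions of \<open>f\<close> and \<open>g\<close> live on different
  neighbourhoods, so an operation preserving \<open>ck_on\<close> is applied on their intersection.
  \<open>H\<close> will be addition or a bounded bilinear map.\<close>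

lemma smooth_on_binary:
  fixes f :: "'a::euclidean_space \<Rightarrow> 'b::real_normed_vector" and g :: "'a \<Rightarrow> 'c::real_normed_vector"
    and H :: "'b \<Rightarrow> 'c \<Rightarrow> 'd::real_normed_vector"
  assumes "smooth_on S f" "smooth_on S g"
    and H: "\<And>k U (u :: 'a \<Rightarrow> 'b) v. open U \<Longrightarrow> ck_on k U u \<Longrightarrow> ck_on k U v \<Longrightarrow> ck_on k U (\<lambda>x. H (u x) (v x))"
  shows "smooth_on S (\<lambda>x. H (f x) (g x))"
proof (rule smooth_onI)
  fix x assume x: "x \<in> S"
  obtain U u where U: "open U" "x \<in> U" "\<And>k. ck_on k U u" "\<And>y. y \<in> S \<Longrightarrow> y \<in> U \<Longrightarrow> u y = f y"
    by (rule smooth_onE[OF assms(1) x]) (rule that)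
  obtain V v where V: "open V" "x \<in> V" "\<And>k. ck_on k V v" "\<And>y. y \<in> S \<Longrightarrow> y \<in> V \<Longrightarrow> v y = g y"
    by (rule smooth_onE[OF assms(2) x]) (rule that)
  have "ck_on k (U \<inter> V) (\<lambda>x. H (u x) (v x))" for k
    by (rule H[OF open_Int[OF U(1) V(1)] ck_on_subset[OF U(3)] ck_on_subset[OF V(3)]]) auto
  with U V show "\<exists>U h. open U \<and> x \<in> U \<and> (\<forall>k. ck_on k U h) \<and> (\<forall>y\<in>S \<inter> U. h y = H (f y) (g y))"
    by (intro exI[of _ "U \<inter> V"] exI[of _ "\<lambda>x. H (u x) (v x)"]) auto
qed

lemma smooth_on_add: "smooth_on S f \<Longrightarrow> smooth_on S g \<Longrightarrow> smooth_on S (\<lambda>x. f x + g x)"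
  by (rule smooth_on_binary[where H = "(+)"], assumption+) (rule ck_on_add)

lemma smooth_on_bilinear:
  "bounded_bilinear B \<Longrightarrow> smooth_on S f \<Longrightarrow> smooth_on S g \<Longrightarrow> smooth_on S (\<lambda>x. B (f x) (g x))"
  by (rule smooth_on_binary[where H = B], assumption+) (rule ck_on_bilinear)

lemmas smooth_on_mult = smooth_on_bilinear[OF bounded_bilinear_mult]

lemma smooth_on_sum:
  "(\<And>i. i \<in> I \<Longrightarrow> smooth_on S (f i)) \<Longrightarrow> smooth_on S (\<lambda>x. \<Sum>i\<in>I. f i x)"
  by (induction I rule: infinite_finite_induct) (auto intro: smooth_on_const smooth_on_add)

lemma smooth_on_compose:
  fixes f :: "'a::euclidean_space \<Rightarrow> 'b::euclidean_space" and g :: "'b \<Rightarrow> 'c::real_normed_vector"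
  assumes "smooth_on S f" "smooth_on T g" "f ` S \<subseteq> T"
  shows "smooth_on S (\<lambda>x. g (f x))"
proof (rule smooth_onI)
  fix x assume x: "x \<in> S"
  obtain U u where U: "open U" "x \<in> U" "\<And>k. ck_on k U u" "\<And>y. y \<in> S \<Longrightarrow> y \<in> U \<Longrightarrow> u y = f y"
    by (rule smooth_onE[OF assms(1) x]) (rule that)
  have "f x \<in> T"
    using x assms(3) by blast
  then obtain V v where V: "open V" "f x \<in> V" "\<And>k. ck_on k V v" "\<And>y. y \<in> T \<Longrightarrow> y \<in> V \<Longrightarrow> v y = g y"
    by (rule smooth_onE[OF assms(2)]) (rule that)
  \<comment> \<open>The extension \<open>u\<close> of \<open>f\<close> need not stay in
    \<open>V\<close>, where the extension of \<open>g\<close> is smooth; shrinking to the preimage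
    repairs this.\<close>
  let ?W = "U \<inter> u -` V"
  have W: "open ?W"
    using continuous_open_preimage[OF ck_on_imp_continuous_on[OF U(3)] U(1) V(1)] .
  have "ck_on k ?W (\<lambda>x. v (u x))" for k
    by (rule ck_on_compose[OF W V(1) _ ck_on_subset[OF U(3)] V(3)]) auto
  moreover have "v (u y) = g (f y)" if "y \<in> S \<inter> ?W" for y
    using that U V assms(3) by auto
  moreover have "x \<in> ?W"
    using U V x by auto
  ultimately show "\<exists>U h. open U \<and> x \<in> U \<and> (\<forall>k. ck_on k U h) \<and> (\<forall>y\<in>S \<inter> U. h y = g (f y))"
    using W by (intro exI[of _ ?W] exI[of _ "\<lambda>x. v (u x)"]) auto
qed

lemma smooth_on_Pair:
  fixes f :: "'a::euclidean_space \<Rightarrow> 'b::real_normed_vector" and g :: "'a \<Rightarrow> 'c::real_normed_vector"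
  assumes "smooth_on S f" "smooth_on S g"
  shows "smooth_on S (\<lambda>x. (f x, g x))"
proof -
  have "bounded_linear (\<lambda>y::'b. (y, 0::'c))" "bounded_linear (\<lambda>y::'c. (0::'b, y))"
    by (auto intro!: bounded_linear_Pair bounded_linear_ident bounded_linear_zero)
  then have "smooth_on S (\<lambda>x. (f x, 0::'c) + (0::'b, g x))"
    using assms by (intro smooth_on_add) (rule smooth_on_bounded_linear, assumption, assumption)+
  then show ?thesis by simp
qed

lemmas smooth_on_fst = smooth_on_bounded_linear[OF bounded_linear_fst]
lemmas smooth_on_snd = smooth_on_bounded_linear[OF bounded_linear_snd]

text \<open>A matrix is the finite sum of its entries, each carried to its place by the bounded
  linear map \<open>axis i (axis j z)\<close>.\<close>

lemma smooth_on_matrix: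
  fixes f :: "'a::euclidean_space \<Rightarrow> complex^'n^'m"
  assumes "\<And>i j. smooth_on S (\<lambda>x. f x $ i $ j)"
  shows "smooth_on S f"
proof -
  have axis: "bounded_linear (\<lambda>z::complex. axis i (axis j z) :: complex^'n^'m)" for i j
    by (intro linear_conv_bounded_linear[THEN iffD1] linearI) (simp_all add: axis_def vec_eq_iff)
  have "smooth_on S (\<lambda>x. \<Sum>i\<in>UNIV. \<Sum>j\<in>UNIV. axis i (axis j (f x $ i $ j)) :: complex^'n^'m)"
    by (intro smooth_on_sum smooth_on_bounded_linear[OF axis] assms)
  moreover have "(\<Sum>i\<in>UNIV. \<Sum>j\<in>UNIV. axis i (axis j (f x $ i $ j))) = f x" for x
  proof -
    have "axis i (axis j z) $ k $ l = (if l = j then if k = i then z else 0 else 0)"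
      for i k :: 'm and j l :: 'n and z :: complex
      by (simp add: axis_def)
    then show ?thesis by (simp add: vec_eq_iff)
  qed
  ultimately show ?thesis by simp
qed

lemma smooth_on_component:
  "smooth_on S f \<Longrightarrow> smooth_on S (\<lambda>x. f x $ i $ j)"
  for f :: "'a::euclidean_space \<Rightarrow> complex^'n^'m"
  by (rule smooth_on_bounded_linear[where f = "\<lambda>x. f x $ i", OF bounded_linear_vec_nth])
    (rule smooth_on_bounded_linear[where f = f, OF bounded_linear_vec_nth])

section \<open>Loop spaces\<close>

lemma smooth_into_compose:
  fixes h :: "'x::euclidean_space \<Rightarrow> 'y::euclidean_space"
  assumes "smooth_into A c" "smooth_on UNIV h"
  shows "smooth_into A (\<lambda>x. c (h x))"
  unfolding smooth_into_def
proof (intro conjI ballI, goal_cases)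
  case 1
  then show ?case using assms(1) unfolding smooth_into_def by blast
next
  case (2 V)
  obtain U \<psi> where V: "V = (U, \<psi>)" by (cases V)
  with 2 assms(1) have c: "open (c -` U)" "smooth_on (c -` U) (\<psi> \<circ> c)"
    unfolding smooth_into_def by blast+
  have "(\<lambda>x. c (h x)) -` U = h -` (c -` U)" by auto
  moreover have "open (h -` (c -` U))"
    using continuous_open_preimage[OF smooth_on_imp_continuous_on[OF assms(2)] open_UNIV c(1)] by simp
  moreover have "smooth_on (h -` (c -` U)) (\<lambda>x. (\<psi> \<circ> c) (h x))"
    by (rule smooth_on_compose[OF smooth_on_subset[OF assms(2)] c(2)]) auto
  ultimately show ?case by (simp add: V comp_def)
qed

lemma loops_rotate:
  assumes "\<gamma> \<in> loops A"
  shows "loop_rotate t \<gamma> \<in> loops A"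
proof -
  have "smooth_into A (\<lambda>\<theta>. \<gamma> (\<theta> + t))"
    using assms smooth_on_add[OF smooth_on_ident smooth_on_const]
    by (intro smooth_into_compose[where h = "\<lambda>\<theta>. \<theta> + t"]) (simp_all add: loops_def)
  moreover have "\<gamma> (\<theta> + 2 * pi + t) = \<gamma> (\<theta> + t)" for \<theta>
  proof -
    have "\<gamma> (\<theta> + t + 2 * pi) = \<gamma> (\<theta> + t)"
      using assms unfolding loops_def by blast
    then show ?thesis
      by (simp add: add.assoc add.commute[of t])
  qed
  ultimately show ?thesis
    by (simp add: loops_def loop_rotate_def)
qed

lemma loop_rotate_rotate: "loop_rotate s (loop_rotate t \<gamma>) = loop_rotate (s + t) \<gamma>"
  by (simp add: loop_rotate_def algebra_simps)

lemma loop_rotate_0 [simp]: "loop_rotate 0 \<gamma> = \<gamma>"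
  by (simp add: loop_rotate_def)

section \<open>The topology of loop spaces\<close>

lemma loop_nbhd_refl:
  "\<gamma> \<in> loops A \<Longrightarrow> \<gamma> ` {a..b} \<subseteq> U \<Longrightarrow> \<epsilon> > 0 \<Longrightarrow> \<gamma> \<in> loop_nbhd A \<gamma> U \<psi> a b r \<epsilon>"
  by (simp add: loop_nbhd_def)

lemma openin_loop_nbhd:
  assumes "\<gamma> \<in> loops A" "(U, \<psi>) \<in> A" "a \<le> b" "\<gamma> ` {a..b} \<subseteq> U" "\<epsilon> > 0"
  shows "openin (loop_topology A) (loop_nbhd A \<gamma> U \<psi> a b r \<epsilon>)"
  unfolding loop_topology_def
  by (rule topology_generated_by_Basis) (use assms in blast)

lemma topspace_loop_topology [simp]: "topspace (loop_topology A) = loops A"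
proof
  show "topspace (loop_topology A) \<subseteq> loops A"
    by (auto simp: loop_topology_def topology_generated_by_topspace loop_nbhd_def)
  show "loops A \<subseteq> topspace (loop_topology A)"
  proof
    fix \<gamma> assume \<gamma>: "\<gamma> \<in> loops A"
    then have "\<gamma> 0 \<in> \<Union>(fst ` A)"
      unfolding loops_def smooth_into_def by blast
    then obtain U \<psi> where U: "(U, \<psi>) \<in> A" "\<gamma> 0 \<in> U"
      by auto
    \<comment> \<open>A degenerate interval and order 0 suffice: one chart around the value at 0
      already gives a subbasic set containing the loop.\<close>
    have "\<gamma> \<in> loop_nbhd A \<gamma> U \<psi> 0 0 0 1"
      by (rule loop_nbhd_refl[OF \<gamma>]) (use U in auto)
    moreover have "openin (loop_topology A) (loop_nbhd A \<gamma> U \<psi> 0 0 0 1)"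
      by (rule openin_loop_nbhd[OF \<gamma> U(1)]) (use U in auto)
    ultimately show "\<gamma> \<in> topspace (loop_topology A)"
      using openin_subset by blast
  qed
qed

lemma points_loop_space [simp]: "points (loop_space A) = loops A"
  by (simp add: loop_space_def)

lemma scurves_loop_space:
  "c \<in> scurves (loop_space A) \<longleftrightarrow> range c \<subseteq> loops A \<and> smooth_into A (\<lambda>(s, \<theta>). c s \<theta>)"
  by (simp add: loop_space_def)

text \<open>The sets \<open>loop_nbhd\<close> form only a subbasis, and \<open>f x\<close> may be an
  off-centre member of such a set. Hence the second premise concerns every \<open>loop_nbhd\<close>
  containing \<open>f x\<close>, whatever its centre \<gamma>.\<close>

lemma continuous_map_loop_topologyI:
  assumes "\<And>x. x \<in> topspace T \<Longrightarrow> f x \<in> loops A"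
    and "\<And>x \<gamma> U \<psi> a b r \<epsilon>. \<lbrakk>x \<in> topspace T; \<gamma> \<in> loops A; (U, \<psi>) \<in> A; a \<le> b; \<gamma> ` {a..b} \<subseteq> U; \<epsilon> > 0;
      f x \<in> loop_nbhd A \<gamma> U \<psi> a b r \<epsilon>\<rbrakk>
      \<Longrightarrow> \<exists>N. openin T N \<and> x \<in> N \<and> (\<forall>y\<in>N. f y \<in> loop_nbhd A \<gamma> U \<psi> a b r \<epsilon>)"
  shows "continuous_map T (loop_topology A) f"
  unfolding loop_topology_def
proof (rule continuous_on_generated_topo)
  fix W assume "W \<in> {loop_nbhd A \<gamma> U \<psi> a b r \<epsilon> | \<gamma> U \<psi> a b r \<epsilon>.
        \<gamma> \<in> loops A \<and> (U, \<psi>) \<in> A \<and> a \<le> b \<and> \<gamma> ` {a..b} \<subseteq> U \<and> \<epsilon> > 0}"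
  then obtain \<gamma> U \<psi> a b r \<epsilon> where W: "W = loop_nbhd A \<gamma> U \<psi> a b r \<epsilon>"
    "\<gamma> \<in> loops A" "(U, \<psi>) \<in> A" "a \<le> b" "\<gamma> ` {a..b} \<subseteq> U" "\<epsilon> > 0"
    by blast
  show "openin T (f -` W \<inter> topspace T)"
  proof (subst openin_subopen, intro ballI)
    fix x assume x: "x \<in> f -` W \<inter> topspace T"
    then obtain N where N: "openin T N" "x \<in> N" "\<forall>y\<in>N. f y \<in> W"
      using assms(2)[OF _ W(2-6), of x r] unfolding W(1) by blast
    then show "\<exists>N. openin T N \<and> x \<in> N \<and> N \<subseteq> f -` W \<inter> topspace T"
      using openin_subset by blast
  qed
next
  show "f ` topspace T \<subseteq> \<Union>{loop_nbhd A \<gamma> U \<psi> a b r \<epsilon> | \<gamma> U \<psi> a b r \<epsilon>.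
        \<gamma> \<in> loops A \<and> (U, \<psi>) \<in> A \<and> a \<le> b \<and> \<gamma> ` {a..b} \<subseteq> U \<and> \<epsilon> > 0}"
    using assms(1) topspace_loop_topology[of A]
    unfolding loop_topology_def topology_generated_by_topspace by blast
qed

section \<open>Derivatives of loops and of families of loops\<close>

lemma vector_derivative_shift:
  "vector_derivative (\<lambda>\<theta>. f (\<theta> + t)) (at \<theta>) = vector_derivative f (at (\<theta> + t))"
  for f :: "real \<Rightarrow> 'b::real_normed_vector"
proof -
  have *: "((\<lambda>\<theta>. h (\<theta> + u)) has_vector_derivative D) (at x)"
    if "(h has_vector_derivative D) (at (x + u))" for h :: "real \<Rightarrow> 'b" and u x D
  proof -
    have "((\<lambda>\<theta>. \<theta> + u) has_vector_derivative 1) (at x)"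
      by (auto intro!: derivative_eq_intros)
    from vector_diff_chain_at[OF this that] show ?thesis
      by (simp add: comp_def)
  qed
  \<comment> \<open>An equivalence for every \<open>D\<close> makes the two choices behind
    \<open>vector_derivative\<close> coincide even where no derivative exists, so no
    differentiability is assumed.\<close>
  have "((\<lambda>\<theta>. f (\<theta> + t)) has_vector_derivative D) (at \<theta>) \<longleftrightarrow>
      (f has_vector_derivative D) (at (\<theta> + t))" for D
    using *[of f D \<theta> t] *[of "\<lambda>\<theta>. f (\<theta> + t)" D "\<theta> + t" "- t"] by auto
  then show ?thesis
    by (simp add: vector_derivative_def)
qed

lemma curve_deriv_shift:
  "curve_deriv k (\<lambda>\<theta>. f (\<theta> + t)) = (\<lambda>\<theta>. curve_deriv k f (\<theta> + t))"
  by (induction k) (simp_all add: curve_deriv_def vector_derivative_shift)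

text \<open>Derivatives of single loops are taken with \<open>s\<close> frozen. They are partial
  derivatives of \<open>f\<close>, so they inherit joint regularity in \<open>s\<close> and
  \<theta>. Carrying all orders of \<open>g\<close> leaves a derivative to spare at each induction
  step.\<close>

lemma curve_deriv_smooth:
  fixes f :: "real \<times> real \<Rightarrow> 'b::real_normed_vector"
  assumes "open W" "\<And>k. ck_on k W f"
  shows "\<exists>g. (\<forall>m. ck_on m W g) \<and>
    (\<forall>s \<theta>. (s, \<theta>) \<in> W \<longrightarrow> curve_deriv k (\<lambda>\<theta>. f (s, \<theta>)) \<theta> = g (s, \<theta>))"
proof (induction k)
  case 0
  then show ?case using assms(2) by (auto simp: curve_deriv_def)
next
  case (Suc k)
  then obtain g where g: "\<And>m. ck_on m W g"
    "\<And>s \<theta>. (s, \<theta>) \<in> W \<Longrightarrow> curve_deriv k (\<lambda>\<theta>. f (s, \<theta>)) \<theta> = g (s, \<theta>)"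
    by blast
  let ?g = "\<lambda>x. frechet_derivative g (at x) (0, 1)"
  have "curve_deriv (Suc k) (\<lambda>\<theta>. f (s, \<theta>)) \<theta> = ?g (s, \<theta>)" if "(s, \<theta>) \<in> W" for s \<theta>
  proof -
    have D: "(g has_derivative frechet_derivative g (at (s, \<theta>))) (at (s, \<theta>))"
      by (rule ck_on_Suc_has_derivative[OF g(1)[of "Suc 0"] that])
    have "((\<lambda>\<theta>. (s, \<theta>)) has_derivative (\<lambda>h. (0, h))) (at \<theta>)"
      by (auto intro!: derivative_eq_intros)
    note has_derivative_compose[OF this, of g, OF D]
    also have "(\<lambda>h. frechet_derivative g (at (s, \<theta>)) (0, h)) = (\<lambda>h. h *\<^sub>R ?g (s, \<theta>))"
    proof
      show "frechet_derivative g (at (s, \<theta>)) (0, h) = h *\<^sub>R ?g (s, \<theta>)" for h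
        using linear_cmul[OF has_derivative_linear[OF D], of h "(0, 1)"] by simp
    qed
    finally have "((\<lambda>\<theta>. g (s, \<theta>)) has_vector_derivative ?g (s, \<theta>)) (at \<theta>)"
      unfolding has_vector_derivative_def .
    \<comment> \<open>The induction hypothesis identifies \<open>curve_deriv k\<close> with
      \<open>g\<close> only inside \<open>W\<close>; an open slice is enough to transfer the
      derivative.\<close>
    moreover have "open ((\<lambda>\<theta>. (s, \<theta>)) -` W)"
      by (intro open_vimage assms(1) continuous_intros)
    ultimately have "(curve_deriv k (\<lambda>\<theta>. f (s, \<theta>)) has_vector_derivative ?g (s, \<theta>)) (at \<theta>)"
      by (rule has_vector_derivative_transform_within_open) (use that g(2) in auto)
    then show ?thesis
      by (simp add: curve_deriv_def vector_derivative_at)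
  qed
  moreover have "ck_on m W ?g" for m
    using g(1)[of "Suc m"] by simp
  ultimately show ?case by blast
qed

lemma continuous_on_curve_deriv2:
  fixes f :: "real \<times> real \<Rightarrow> 'b::real_normed_vector"
  assumes "open W" "smooth_on W f"
  shows "continuous_on W (\<lambda>x. curve_deriv k (\<lambda>\<theta>. f (fst x, \<theta>)) (snd x))"
proof -
  obtain g where g: "\<And>m. ck_on m W g"
    "\<And>s \<theta>. (s, \<theta>) \<in> W \<Longrightarrow> curve_deriv k (\<lambda>\<theta>. f (s, \<theta>)) \<theta> = g (s, \<theta>)"
    using curve_deriv_smooth[OF assms(1) smooth_on_openD[OF assms]] by blast
  show ?thesis
    by (rule continuous_on_eq[OF ck_on_imp_continuous_on[OF g(1)]]) (use g(2) in auto)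
qed

lemma continuous_on_curve_deriv:
  fixes h :: "real \<Rightarrow> 'b::real_normed_vector"
  assumes "open G" "smooth_on G h"
  shows "continuous_on G (curve_deriv k h)"
proof -
  \<comment> \<open>A single function is treated as a family that does not depend on its
    parameter.\<close>
  have "smooth_on ((UNIV :: real set) \<times> G) (\<lambda>x. h (snd x))"
    by (rule smooth_on_compose[OF smooth_on_snd[OF smooth_on_ident] assms(2)]) auto
  from continuous_on_curve_deriv2[OF _ this]
  have "continuous_on ((UNIV :: real set) \<times> G) (\<lambda>x. curve_deriv k h (snd x))"
    using assms(1) by (simp add: open_Times)
  moreover have "continuous_on G (\<lambda>\<theta>. (0 :: real, \<theta>))"
    by (intro continuous_on_Pair continuous_on_const continuous_on_id)
  ultimately have "continuous_on G (\<lambda>\<theta>. curve_deriv k h (snd (0 :: real, \<theta>)))"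
    by (rule continuous_on_compose2) auto
  then show ?thesis by simp
qed

lemma loops_chart:
  assumes "\<gamma> \<in> loops A" "(U, \<psi>) \<in> A"
  shows "open (\<gamma> -` U)" "continuous_on (\<gamma> -` U) (curve_deriv k (\<psi> \<circ> \<gamma>))"
proof -
  have "open (\<gamma> -` U)" "smooth_on (\<gamma> -` U) (\<psi> \<circ> \<gamma>)"
    using assms unfolding loops_def smooth_into_def by blast+
  then show "open (\<gamma> -` U)" "continuous_on (\<gamma> -` U) (curve_deriv k (\<psi> \<circ> \<gamma>))"
    by (auto intro: continuous_on_curve_deriv)
qed

section \<open>Continuity of smooth curves and of rotations in the loop topology\<close>

lemma open_deriv_less:
  fixes F H :: "'b::topological_space \<Rightarrow> 'c::real_normed_vector"
  assumes "open W" "continuous_on W F" "continuous_on W H"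
  shows "open {x \<in> W. norm (F x - H x) < \<epsilon>}"
proof -
  have "continuous_on W (\<lambda>x. norm (F x - H x))"
    using assms by (intro continuous_intros)
  then have "open (W \<inter> (\<lambda>x. norm (F x - H x)) -` {..<\<epsilon>})"
    by (rule continuous_open_preimage[OF _ assms(1) open_lessThan])
  moreover have "{x \<in> W. norm (F x - H x) < \<epsilon>} = W \<inter> (\<lambda>x. norm (F x - H x)) -` {..<\<epsilon>}"
    by auto
  ultimately show ?thesis by simp
qed

text \<open>Smoothness of the adjoint gives joint continuity of the chart derivatives, whereas the
  topology demands bounds uniform over \<open>{a..b}\<close>. Compactness of that interval and the
  tube lemma bridge the two.\<close>

lemma scurve_continuous_map:
  assumes "c \<in> scurves (loop_space A)"
  shows "continuous_map euclideanreal (loop_topology A) c"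
proof (rule continuous_map_loop_topologyI)
  have c: "range c \<subseteq> loops A" "smooth_into A (\<lambda>(s, \<theta>). c s \<theta>)"
    using assms by (auto simp: scurves_loop_space)
  then show "c s \<in> loops A" for s by auto
  fix s0 \<gamma> U \<psi> a b r \<epsilon>
  assume \<gamma>: "\<gamma> \<in> loops A" "(U, \<psi>) \<in> A" "a \<le> b" "\<gamma> ` {a..b} \<subseteq> U" "\<epsilon> > (0::real)"
    and s0: "c s0 \<in> loop_nbhd A \<gamma> U \<psi> a b r \<epsilon>"
  let ?W = "(\<lambda>(s, \<theta>). c s \<theta>) -` U"
  let ?F = "\<lambda>k x. curve_deriv k (\<lambda>\<theta>. \<psi> (c (fst x) \<theta>)) (snd x)"
  have W: "open ?W" "smooth_on ?W (\<psi> \<circ> (\<lambda>(s, \<theta>). c s \<theta>))"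
    using c(2) \<gamma>(2) unfolding smooth_into_def by blast+
  have F: "continuous_on ?W (?F k)" for k
    using continuous_on_curve_deriv2[OF W, of k] by simp
  \<comment> \<open>Intersecting with the preimage of \<open>U\<close> under \<gamma> keeps the
    derivatives of the centre of the neighbourhood continuous too.\<close>
  let ?G = "?W \<inter> UNIV \<times> (\<gamma> -` U)"
  have G: "open ?G"
    using W(1) loops_chart(1)[OF \<gamma>(1,2)] by (intro open_Int open_Times) auto
  have H: "continuous_on ?G (\<lambda>x. curve_deriv k (\<psi> \<circ> \<gamma>) (snd x))" for k
    by (rule continuous_on_compose2[OF loops_chart(2)[OF \<gamma>(1,2)] continuous_on_snd[OF continuous_on_id]]) auto
  let ?O = "?G \<inter> (\<Inter>k\<le>r. {x \<in> ?G. norm (?F k x - curve_deriv k (\<psi> \<circ> \<gamma>) (snd x)) < \<epsilon>})"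
  have O: "open ?O"
    by (intro open_Int G open_INT finite_atMost ballI open_deriv_less continuous_on_subset[OF F] H) auto
  have "{s0} \<times> {a..b} \<subseteq> ?O"
    using s0 \<gamma>(4) by (auto simp: loop_nbhd_def comp_def)
  from Elementary_Topology.tube_lemma[OF compact_Icc O this]
  obtain N where N: "s0 \<in> N" "open N" "N \<times> {a..b} \<subseteq> ?O"
    by (elim exE conjE)
  have "c s \<in> loop_nbhd A \<gamma> U \<psi> a b r \<epsilon>" if "s \<in> N" for s
  proof -
    have sO: "(s, \<theta>) \<in> ?O" if "\<theta> \<in> {a..b}" for \<theta>
      by (rule subsetD[OF N(3)]) (use that \<open>s \<in> N\<close> in simp)
    have "c s \<theta> \<in> U" "k \<le> r \<Longrightarrow> norm (curve_deriv k (\<psi> \<circ> c s) \<theta> - curve_deriv k (\<psi> \<circ> \<gamma>) \<theta>) < \<epsilon>"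
      if "\<theta> \<in> {a..b}" for k \<theta>
      using sO[OF that] by (simp_all add: comp_def)
    then show ?thesis
      using c(1) by (simp add: loop_nbhd_def image_subset_iff)
  qed
  then show "\<exists>N. openin euclideanreal N \<and> s0 \<in> N \<and> (\<forall>y\<in>N. c y \<in> loop_nbhd A \<gamma> U \<psi> a b r \<epsilon>)"
    using N(1,2) by (intro exI[of _ N]) (simp add: open_openin[symmetric])
qed

text \<open>For \<delta> near \<delta>0 and t near t0, the error against \<gamma> splits into three:
  \<delta> versus \<delta>0 at \<theta> + t, \<delta>0 at \<theta> + t versus \<theta> + t0, and
  \<delta>0 at \<theta> + t0 versus \<gamma> at \<theta>. The last stays uniformly below \<epsilon>,
  and the room left is shared by the first two.\<close>

lemma continuous_map_loop_rotate:
  "continuous_map (prod_topology euclideanreal (loop_topology A)) (loop_topology A)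
     (\<lambda>(t, \<delta>). loop_rotate t \<delta>)"
proof (rule continuous_map_loop_topologyI)
  show "(case x of (t, \<delta>) \<Rightarrow> loop_rotate t \<delta>) \<in> loops A"
    if "x \<in> topspace (prod_topology euclideanreal (loop_topology A))" for x
    using that by (auto intro: loops_rotate)
next
  fix x \<gamma> U \<psi> a b r \<epsilon>
  assume x: "x \<in> topspace (prod_topology euclideanreal (loop_topology A))"
    and \<gamma>: "\<gamma> \<in> loops A" "(U, \<psi>) \<in> A" "a \<le> b" "\<gamma> ` {a..b} \<subseteq> U" "\<epsilon> > (0::real)"
    and nx: "(case x of (t, \<delta>) \<Rightarrow> loop_rotate t \<delta>) \<in> loop_nbhd A \<gamma> U \<psi> a b r \<epsilon>"
  obtain t0 \<delta>0 where x_eq: "x = (t0, \<delta>0)" by (cases x)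
  have \<delta>0: "\<delta>0 \<in> loops A" using x by (simp add: x_eq)
  have shift: "curve_deriv k (\<psi> \<circ> loop_rotate t \<delta>) \<theta> = curve_deriv k (\<psi> \<circ> \<delta>) (\<theta> + t)" for k t \<delta> \<theta>
    using curve_deriv_shift[of k "\<psi> \<circ> \<delta>" t] by (simp add: loop_rotate_def comp_def)
  have n0: "\<delta>0 (\<theta> + t0) \<in> U"
    "k \<le> r \<Longrightarrow> norm (curve_deriv k (\<psi> \<circ> \<delta>0) (\<theta> + t0) - curve_deriv k (\<psi> \<circ> \<gamma>) \<theta>) < \<epsilon>"
    if "\<theta> \<in> {a..b}" for k \<theta>
    using nx that by (auto simp: x_eq loop_nbhd_def shift) (auto simp: loop_rotate_def)
  let ?h = "\<lambda>k \<theta>. norm (curve_deriv k (\<psi> \<circ> \<delta>0) (\<theta> + t0) - curve_deriv k (\<psi> \<circ> \<gamma>) \<theta>)"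
  \<comment> \<open>The given strict inequality is pointwise; on the compact interval its left side
    attains a maximum, which leaves a uniform margin below \<epsilon>.\<close>
  have "\<exists>e<\<epsilon>. \<forall>\<theta>\<in>{a..b}. ?h k \<theta> \<le> e" if "k \<le> r" for k
  proof -
    have 1: "continuous_on {a..b} (curve_deriv k (\<psi> \<circ> \<gamma>))"
      by (rule continuous_on_subset[OF loops_chart(2)[OF \<gamma>(1,2)]]) (use \<gamma>(4) in auto)
    have 2: "continuous_on {a..b} (\<lambda>\<theta>. curve_deriv k (\<psi> \<circ> \<delta>0) (\<theta> + t0))"
      by (rule continuous_on_compose2[OF loops_chart(2)[OF \<delta>0 \<gamma>(2)]
            continuous_on_add[OF continuous_on_id continuous_on_const]]) (use n0(1) in blast)
    have "continuous_on {a..b} (?h k)"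
      by (intro continuous_intros 1 2)
    then obtain \<theta>' where "\<theta>' \<in> {a..b}" "\<forall>\<theta>\<in>{a..b}. ?h k \<theta> \<le> ?h k \<theta>'"
      using continuous_attains_sup[of "{a..b}" "?h k"] \<gamma>(3) by auto
    then show ?thesis using n0(2)[OF _ that] by blast
  qed
  then have "\<exists>e. \<forall>k\<le>r. e k < \<epsilon> \<and> (\<forall>\<theta>\<in>{a..b}. ?h k \<theta> \<le> e k)"
    by (intro choice) blast
  then obtain e where e: "\<And>k. k \<le> r \<Longrightarrow> e k < \<epsilon>" "\<And>k \<theta>. k \<le> r \<Longrightarrow> \<theta> \<in> {a..b} \<Longrightarrow> ?h k \<theta> \<le> e k"
    by blast
  define e' where "e' = Max (e ` {..r})"
  have e': "e' < \<epsilon>" "\<And>k \<theta>. k \<le> r \<Longrightarrow> \<theta> \<in> {a..b} \<Longrightarrow> ?h k \<theta> \<le> e'"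
    using e unfolding e'_def by (auto simp: Max_ge_iff)
  \<comment> \<open>Half of the margin: one share for each of the other two errors.\<close>
  define d where "d = (\<epsilon> - e') / 2"
  have d: "d > 0" "e' + d + d = \<epsilon>" using e'(1) by (auto simp: d_def field_simps)
  let ?G = "{x. snd x + fst x \<in> \<delta>0 -` U \<and> snd x + t0 \<in> \<delta>0 -` U} :: (real \<times> real) set"
  let ?F = "\<lambda>k x. curve_deriv k (\<psi> \<circ> \<delta>0) (snd x + fst x)"
  let ?H = "\<lambda>k x. curve_deriv k (\<psi> \<circ> \<delta>0) (snd x + t0)"
  have "open ((\<lambda>x. snd x + fst x) -` (\<delta>0 -` U) \<inter> (\<lambda>x. snd x + t0) -` (\<delta>0 -` U) :: (real \<times> real) set)"
    by (intro open_Int open_vimage loops_chart(1)[OF \<delta>0 \<gamma>(2)] continuous_intros)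
  then have G: "open ?G"
    by (simp add: Int_def vimage_def)
  have F: "continuous_on ?G (?F k)" for k
    by (rule continuous_on_compose2[OF loops_chart(2)[OF \<delta>0 \<gamma>(2)]
          continuous_on_add[OF continuous_on_snd[OF continuous_on_id] continuous_on_fst[OF continuous_on_id]]])
      auto
  have H: "continuous_on ?G (?H k)" for k
    by (rule continuous_on_compose2[OF loops_chart(2)[OF \<delta>0 \<gamma>(2)]
          continuous_on_add[OF continuous_on_snd[OF continuous_on_id] continuous_on_const]]) auto
  let ?O = "?G \<inter> (\<Inter>k\<le>r. {x \<in> ?G. norm (?F k x - ?H k x) < d})"
  have O: "open ?O"
    by (intro open_Int G open_INT finite_atMost ballI open_deriv_less F H)
  have "{t0} \<times> {a..b} \<subseteq> ?O"
    using n0(1) d(1) by auto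
  from Elementary_Topology.tube_lemma[OF compact_Icc O this]
  obtain N where N: "t0 \<in> N" "open N" "N \<times> {a..b} \<subseteq> ?O"
    by (elim exE conjE)
  obtain \<eta>' where \<eta>': "\<eta>' > 0" "ball t0 \<eta>' \<subseteq> N"
    using N openE by blast
  \<comment> \<open>Halving makes the closed interval of radius \<eta> fit into the open
    ball.\<close>
  define \<eta> where "\<eta> = \<eta>' / 2"
  have \<eta>: "\<eta> > 0" "{t0-\<eta>..t0+\<eta>} \<subseteq> N"
    using \<eta>' by (auto simp: \<eta>_def subset_iff dist_real_def abs_if)
  have NO: "(t, \<theta>) \<in> ?O" if "t \<in> {t0-\<eta>..t0+\<eta>}" "\<theta> \<in> {a..b}" for t \<theta>
    by (rule subsetD[OF N(3)]) (use that \<eta>(2) in blast)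
  have in_U: "\<delta>0 ` {a + t0 - \<eta>..b + t0 + \<eta>} \<subseteq> U"
  proof (rule image_subsetI)
    fix u assume u: "u \<in> {a + t0 - \<eta>..b + t0 + \<eta>}"
    \<comment> \<open>The point of \<open>{a..b}\<close> nearest to \<open>u - t0\<close>; the
      remaining shift \<open>u - \<theta>\<close> is then within \<eta> of
      \<open>t0\<close>.\<close>
    define \<theta> where "\<theta> = max a (min b (u - t0))"
    have "\<theta> \<in> {a..b}" "u - \<theta> \<in> {t0-\<eta>..t0+\<eta>}"
      using u \<gamma>(3) \<eta>(1) by (auto simp: \<theta>_def max_def min_def)
    from NO[OF this(2,1)] show "\<delta>0 u \<in> U" by auto
  qed
  \<comment> \<open>Points of \<open>{a..b}\<close> shifted by any \<open>t\<close> within \<eta> of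
    \<open>t0\<close> land in this longer interval, so closeness to \<delta>0 is required
    there.\<close>
  let ?N = "loop_nbhd A \<delta>0 U \<psi> (a + t0 - \<eta>) (b + t0 + \<eta>) r d"
  have rot: "loop_rotate t \<delta> \<in> loop_nbhd A \<gamma> U \<psi> a b r \<epsilon>"
    if t: "t \<in> {t0-\<eta><..<t0+\<eta>}" and \<delta>: "\<delta> \<in> ?N" for t \<delta>
  proof -
    have sh: "\<theta> + t \<in> {a + t0 - \<eta>..b + t0 + \<eta>}" if "\<theta> \<in> {a..b}" for \<theta>
      using t that by auto
    have "norm (curve_deriv k (\<psi> \<circ> \<delta>) (\<theta> + t) - curve_deriv k (\<psi> \<circ> \<gamma>) \<theta>) < \<epsilon>"
      if k: "k \<le> r" "\<theta> \<in> {a..b}" for k \<theta>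
    proof -
      have 1: "norm (curve_deriv k (\<psi> \<circ> \<delta>) (\<theta> + t) - curve_deriv k (\<psi> \<circ> \<delta>0) (\<theta> + t)) < d"
        using \<delta> k(1) sh[OF k(2)] by (auto simp: loop_nbhd_def)
      have 2: "norm (curve_deriv k (\<psi> \<circ> \<delta>0) (\<theta> + t) - curve_deriv k (\<psi> \<circ> \<delta>0) (\<theta> + t0)) < d"
        using NO[of t \<theta>] t k by auto
      show ?thesis
        using norm_triangle_lt[OF add_less_le_mono[OF norm_triangle_lt[OF add_strict_mono[OF 1 2]] e'(2)[OF k]]]
          d(2) by (simp add: algebra_simps)
    qed
    moreover have "\<delta> (\<theta> + t) \<in> U" if "\<theta> \<in> {a..b}" for \<theta>
      using \<delta> sh[OF that] by (auto simp: loop_nbhd_def image_subset_iff)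
    moreover have "loop_rotate t \<delta> \<in> loops A"
      using \<delta> by (intro loops_rotate) (simp add: loop_nbhd_def)
    ultimately show ?thesis
      unfolding loop_nbhd_def by (simp add: shift image_subset_iff) (simp add: loop_rotate_def)
  qed
  have "openin (loop_topology A) ?N"
    by (rule openin_loop_nbhd[OF \<delta>0 \<gamma>(2) _ in_U d(1)]) (use \<gamma>(3) \<eta>(1) in auto)
  moreover have "\<delta>0 \<in> ?N"
    by (rule loop_nbhd_refl[OF \<delta>0 in_U d(1)])
  ultimately show "\<exists>N. openin (prod_topology euclideanreal (loop_topology A)) N \<and> x \<in> N \<and>
      (\<forall>y\<in>N. (case y of (t, \<delta>) \<Rightarrow> loop_rotate t \<delta>) \<in> loop_nbhd A \<gamma> U \<psi> a b r \<epsilon>)"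
    using rot \<eta>(1) by (intro exI[of _ "{t0-\<eta><..<t0+\<eta>} \<times> ?N"]) (auto simp: x_eq openin_prod_Times_iff)
qed

section \<open>Transition matrices of frames\<close>

text \<open>Linearity is assumed only in the first argument; hermitian symmetry transfers it to the
  second, with conjugated coefficients.\<close>

lemma sesquilinear_expand:
  fixes B :: "complex^'n \<Rightarrow> complex^'n \<Rightarrow> complex"
  assumes add: "\<And>u v w. B (u + v) w = B u w + B v w"
    and scale: "\<And>c u w. B (c *s u) w = c * B u w"
    and cnj: "\<And>u v. B v u = cnj (B u v)"
  shows "B p q = (\<Sum>k\<in>UNIV. \<Sum>l\<in>UNIV. p $ k * cnj (q $ l) * B (axis k 1) (axis l 1))"
proof -
  have zero: "B 0 w = 0" for w
    using scale[of 0 0 w] by simp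
  have sum: "B (\<Sum>k\<in>I. h k *s axis k 1) w = (\<Sum>k\<in>I. h k * B (axis k 1) w)"
    for I and h :: "'n \<Rightarrow> complex" and w
    by (induction I rule: infinite_finite_induct) (simp_all add: zero add scale)
  have 1: "B u w = (\<Sum>k\<in>UNIV. u $ k * B (axis k 1) w)" for u w
    using sum[of "\<lambda>k. u $ k" UNIV w] by (simp add: basis_expansion)
  have 2: "B u w = (\<Sum>l\<in>UNIV. cnj (w $ l) * B u (axis l 1))" for u w
    by (subst cnj, subst 1) (simp add: cnj[of "axis _ 1" u])
  show ?thesis
    by (subst 1, subst 2) (simp add: sum_distrib_left mult.assoc)
qed

lemma frame_proj_eq:
  assumes "bij_betw f UNIV (fibre E x)"
  shows "frame_proj E f = x"
proof -
  have "f 0 \<in> fibre E x"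
    using bij_betw_apply[OF assms] by simp
  then show ?thesis
    by (simp add: frame_proj_def fibre_def)
qed

lemma framesE:
  assumes "f \<in> frames X E"
  shows "frame_proj E f \<in> topspace X" "bij_betw f UNIV (fibre E (frame_proj E f))"
    "f (v + w) = fadd E (f v) (f w)" "f (c *s v) = fscale E c (f v)"
    "herm E (f v) (f w) = (\<Sum>i\<in>UNIV. v $ i * cnj (w $ i))"
  using assms frame_proj_eq[of f E] unfolding frames_def by auto

text \<open>For frames over the same point this is the matrix of the inverse of \<open>f\<close>
  after \<open>g\<close>. Reading its entries off by pairing with the orthonormal frame
  \<open>f\<close> avoids the inverse and makes smooth dependence visible.\<close>

definition frame_trans ::
    "('m, 'e, 'n::finite) vbundle \<Rightarrow> (complex^'n \<Rightarrow> 'e) \<Rightarrow> (complex^'n \<Rightarrow> 'e) \<Rightarrow> complex^'n^'n" where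
  "frame_trans E f g = (\<chi> i j. herm E (g (axis j 1)) (f (axis i 1)))"

text \<open>Over a common point the inverse of \<open>f\<close> after \<open>g\<close> is a linear
  map of complex coordinate space, and it preserves the standard hermitian form because both frames
  are isometries.\<close>

lemma frame_trans:
  fixes E :: "('m, 'e, 'n::finite) vbundle"
  assumes f: "f \<in> frames X E" and g: "g \<in> frames X E" and eq: "frame_proj E f = frame_proj E g"
  shows "frame_trans E f g \<in> unitary_matrices" "frame_act f (frame_trans E f g) = g"
proof -
  note F = framesE[OF f] and G = framesE[OF g]
  define u where "u v = inv f (g v)" for v
  have inj: "inj f"
    using F(2) by (rule bij_betw_imp_inj_on)
  have fu: "f (u v) = g v" for v
  proof -
    have "g v \<in> range f"
      using bij_betw_apply[OF G(2), of v] bij_betw_imp_surj_on[OF F(2)] eq by simp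
    then show ?thesis
      by (simp add: u_def f_inv_into_f)
  qed
  have "u (v + w) = u v + u w" "u (c *s v) = c *s u v" for c v w
    using F(3,4) G(3,4) by (auto intro!: injD[OF inj] simp: fu)
  then have lin: "Vector_Spaces.linear (*s) (*s) u"
    by (intro Vector_Spaces.linear_iff[THEN iffD2]) (simp add: vec.vector_space_axioms)
  \<comment> \<open>Since \<open>f\<close> is isometric, pairing with \<open>f (axis i 1)\<close>
    picks out coordinate \<open>i\<close> of \<open>u v\<close>.\<close>
  have entry: "u v $ i = herm E (g v) (f (axis i 1))" for v i
  proof -
    have "herm E (f (u v)) (f (axis i 1)) = (\<Sum>k\<in>UNIV. if k = i then u v $ k else 0)"
      unfolding F(5) by (intro sum.cong) (simp_all add: axis_def)
    then show ?thesis by (simp add: fu)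
  qed
  have trans: "frame_trans E f g = matrix u"
    by (simp add: frame_trans_def matrix_def entry)
  show "frame_act f (frame_trans E f g) = g"
    by (rule ext) (simp add: trans frame_act_def matrix_works[OF lin] fu)
  have "(\<Sum>k\<in>UNIV. cnj (u (axis i 1) $ k) * u (axis j 1) $ k) = (if i = j then 1 else 0)" for i j
  proof -
    have "(\<Sum>k\<in>UNIV. cnj (u (axis i 1) $ k) * u (axis j 1) $ k) = herm E (g (axis j 1)) (g (axis i 1))"
      unfolding fu[symmetric] F(5) by (simp add: mult.commute)
    also have "\<dots> = (\<Sum>k\<in>UNIV. if k = i then if i = j then 1 else 0 else 0)"
      unfolding G(5) by (intro sum.cong) (simp_all add: axis_def)
    finally show ?thesis by simp
  qed
  then show "frame_trans E f g \<in> unitary_matrices"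
    by (simp add: trans unitary_matrices_def matrix_matrix_mult_def matrix_def mat_def vec_eq_iff)
qed

lemma frame_trans_self:
  fixes E :: "('m, 'e, 'n::finite) vbundle"
  assumes "f \<in> frames X E"
  shows "frame_trans E f f = mat 1"
proof -
  have "herm E (f (axis j 1)) (f (axis i 1)) = (\<Sum>k\<in>UNIV. if k = i then if i = j then 1 else 0 else 0)" for i j
    unfolding framesE(5)[OF assms] by (intro sum.cong) (simp_all add: axis_def)
  then show ?thesis
    by (simp add: frame_trans_def mat_def vec_eq_iff)
qed

text \<open>The right-hand side contains only what is smooth in a trivialization: the matrices of
  the two frames and the Gram matrix of the metric. It arises by pulling the metric back along the
  inverse of \<open>\<Phi>\<close> and expanding it.\<close>

lemma frame_trans_in_trivialization:
  fixes E :: "('m, 'e, 'n::finite) vbundle"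
  assumes "hermitian_bundle X A E" and W: "(W, \<Phi>) \<in> trivs E"
    and f: "f \<in> frames X E" and g: "g \<in> frames X E"
    and x: "frame_proj E f = x" "frame_proj E g = x" "x \<in> W"
  shows "frame_trans E f g $ i $ j = (\<Sum>k\<in>UNIV. \<Sum>l\<in>UNIV.
    matrix (\<Phi> \<circ> g) $ k $ j * cnj (matrix (\<Phi> \<circ> f) $ l $ i) *
    herm E (inv_into (fibre E x) \<Phi> (axis k 1)) (inv_into (fibre E x) \<Phi> (axis l 1)))"
proof -
  have xX: "x \<in> topspace X"
    using framesE(1)[OF f] x(1) by simp
  have cvb: "complex_vector_bundle X A E"
    using assms(1) by (simp add: hermitian_bundle_def)
  then have "\<forall>x\<in>W. bij_betw \<Phi> (fibre E x) UNIV \<and>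
       (\<forall>u\<in>fibre E x. \<forall>v\<in>fibre E x. fadd E u v \<in> fibre E x \<and> \<Phi> (fadd E u v) = \<Phi> u + \<Phi> v) \<and>
       (\<forall>c. \<forall>u\<in>fibre E x. fscale E c u \<in> fibre E x \<and> \<Phi> (fscale E c u) = c *s \<Phi> u)"
    using W unfolding complex_vector_bundle_def by blast
  then have bij: "bij_betw \<Phi> (fibre E x) UNIV"
    and lin: "\<And>u v. u \<in> fibre E x \<Longrightarrow> v \<in> fibre E x \<Longrightarrow> fadd E u v \<in> fibre E x \<and> \<Phi> (fadd E u v) = \<Phi> u + \<Phi> v"
      "\<And>c u. u \<in> fibre E x \<Longrightarrow> fscale E c u \<in> fibre E x \<and> \<Phi> (fscale E c u) = c *s \<Phi> u"
    using x(3) by blast+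
  have herm: "\<And>u v w. u \<in> fibre E x \<Longrightarrow> v \<in> fibre E x \<Longrightarrow> w \<in> fibre E x \<Longrightarrow>
        herm E (fadd E u v) w = herm E u w + herm E v w"
     "\<And>u v c. u \<in> fibre E x \<Longrightarrow> v \<in> fibre E x \<Longrightarrow> herm E (fscale E c u) v = c * herm E u v"
     "\<And>u v. u \<in> fibre E x \<Longrightarrow> v \<in> fibre E x \<Longrightarrow> herm E v u = cnj (herm E u v)"
    using assms(1) xX unfolding hermitian_bundle_def by blast+
  let ?I = "inv_into (fibre E x) \<Phi>"
  have I: "?I p \<in> fibre E x" "\<Phi> (?I p) = p" for p
    using bij_betw_imp_surj_on[OF bij] by (auto intro: inv_into_into f_inv_into_f)
  have inv: "?I (\<Phi> u) = u" if "u \<in> fibre E x" for u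
    using bij that by (intro inv_into_f_f) (auto simp: bij_betw_def)
  have Iadd: "?I (p + q) = fadd E (?I p) (?I q)" for p q
    using inv[of "fadd E (?I p) (?I q)"] lin(1)[OF I(1) I(1), of p q] by (simp add: I)
  have Iscale: "?I (c *s p) = fscale E c (?I p)" for c p
    using inv[of "fscale E c (?I p)"] lin(2)[OF I(1), of c p] by (simp add: I)
  have expand: "herm E (?I p) (?I q) = (\<Sum>k\<in>UNIV. \<Sum>l\<in>UNIV. p $ k * cnj (q $ l) *
      herm E (?I (axis k 1)) (?I (axis l 1)))" for p q
  proof (rule sesquilinear_expand[where B = "\<lambda>p q. herm E (?I p) (?I q)"])
    show "herm E (?I (u + v)) (?I w) = herm E (?I u) (?I w) + herm E (?I v) (?I w)" for u v w
      by (simp only: Iadd herm(1)[OF I(1) I(1) I(1)])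
    show "herm E (?I (c *s u)) (?I w) = c * herm E (?I u) (?I w)" for c u w
      by (simp only: Iscale herm(2)[OF I(1) I(1)])
    show "herm E (?I v) (?I u) = cnj (herm E (?I u) (?I v))" for u v
      by (rule herm(3)[OF I(1) I(1)])
  qed
  have fib: "f v \<in> fibre E x" "g v \<in> fibre E x" for v
    using bij_betw_apply[OF framesE(2)[OF f]] bij_betw_apply[OF framesE(2)[OF g]] x by auto
  show ?thesis
    using expand[of "\<Phi> (g (axis j 1))" "\<Phi> (f (axis i 1))"]
    by (simp add: frame_trans_def inv fib matrix_def)
qed

lemma smooth_into_frame_charts_frames:
  assumes "smooth_into (frame_charts X A E) c"
  shows "c p \<in> frames X E"
proof -
  have "range c \<subseteq> \<Union>(fst ` frame_charts X A E)"
    using assms unfolding smooth_into_def by blast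
  then show ?thesis
    unfolding frame_charts_def by fastforce
qed

lemma smooth_into_frame_chartsD:
  assumes "smooth_into (frame_charts X A E) c" "(U, \<phi>) \<in> A" "(W, \<Phi>) \<in> trivs E"
  shows "c p \<in> frames X E" "open {p. frame_proj E (c p) \<in> U \<inter> W}"
    "smooth_on {p. frame_proj E (c p) \<in> U \<inter> W} (\<lambda>p. \<phi> (frame_proj E (c p)))"
    "smooth_on {p. frame_proj E (c p) \<in> U \<inter> W} (\<lambda>p. matrix (\<Phi> \<circ> c p))"
proof -
  let ?S = "{f \<in> frames X E. frame_proj E f \<in> U \<inter> W}"
  note fr = smooth_into_frame_charts_frames[OF assms(1)]
  show "c p \<in> frames X E" by (rule fr)
  have "(?S, \<lambda>f. (\<phi> (frame_proj E f), matrix (\<Phi> \<circ> f))) \<in> frame_charts X A E"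
    using assms(2,3) unfolding frame_charts_def by blast
  then have "open (c -` ?S)" "smooth_on (c -` ?S) ((\<lambda>f. (\<phi> (frame_proj E f), matrix (\<Phi> \<circ> f))) \<circ> c)"
    using assms(1) unfolding smooth_into_def by blast+
  moreover have "c -` ?S = {p. frame_proj E (c p) \<in> U \<inter> W}"
    using fr by auto
  ultimately have *: "open {p. frame_proj E (c p) \<in> U \<inter> W}" "smooth_on {p. frame_proj E (c p) \<in> U \<inter> W}
      (\<lambda>p. (\<phi> (frame_proj E (c p)), matrix (\<Phi> \<circ> c p)))"
    by (simp_all add: comp_def)
  then show "open {p. frame_proj E (c p) \<in> U \<inter> W}" by simp
  show "smooth_on {p. frame_proj E (c p) \<in> U \<inter> W} (\<lambda>p. \<phi> (frame_proj E (c p)))"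
    "smooth_on {p. frame_proj E (c p) \<in> U \<inter> W} (\<lambda>p. matrix (\<Phi> \<circ> c p))"
    using smooth_on_fst[OF *(2)] smooth_on_snd[OF *(2)] by simp_all
qed

text \<open>Near each parameter value a chart of the base and a trivialization turn every entry into
  a finite sum of products of smooth functions.\<close>

lemma smooth_on_frame_trans:
  fixes E :: "('m, 'e, 'n::finite) vbundle" and A :: "('m, 'a::euclidean_space) charts"
    and c d :: "'x::euclidean_space \<Rightarrow> complex^'n \<Rightarrow> 'e"
  assumes M: "smooth_manifold X A" and E: "hermitian_bundle X A E"
    and c: "smooth_into (frame_charts X A E) c" and d: "smooth_into (frame_charts X A E) d"
    and eq: "\<And>p. frame_proj E (c p) = frame_proj E (d p)"
  shows "smooth_on UNIV (\<lambda>p. frame_trans E (c p) (d p))"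
proof (rule smooth_on_locally)
  fix p0 :: 'x
  have "frame_proj E (c p0) \<in> topspace X"
    by (rule framesE(1)[OF smooth_into_frame_charts_frames[OF c]])
  moreover have "\<Union>(fst ` A) = topspace X"
    using M by (simp add: smooth_manifold_def)
  moreover have "\<Union>(fst ` trivs E) = topspace X"
    using E by (simp add: hermitian_bundle_def complex_vector_bundle_def)
  ultimately obtain U \<phi> W \<Phi> where UW: "(U, \<phi>) \<in> A" "(W, \<Phi>) \<in> trivs E"
    "frame_proj E (c p0) \<in> U" "frame_proj E (c p0) \<in> W"
    by (metis (no_types, lifting) UN_E prod.collapse)
  note C = smooth_into_frame_chartsD[OF c UW(1,2)]
  note D = smooth_into_frame_chartsD[OF d UW(1,2), folded eq]
  let ?O = "{p. frame_proj E (c p) \<in> U \<inter> W}"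
  have "homeomorphic_map (subtopology X U) (top_of_set (\<phi> ` U)) \<phi>" "openin X U"
    using M UW(1) unfolding smooth_manifold_def by blast+
  \<comment> \<open>The Gram functions are smooth in chart coordinates, that is after
    \<open>inv_into U \<phi>\<close>; injectivity lets this cancel against
    \<open>\<phi>\<close>.\<close>
  then have inj: "inj_on \<phi> U"
    using homeomorphic_imp_injective_map openin_subset
    by (metis inf.absorb2 topspace_subtopology)
  let ?h = "\<lambda>k l x. herm E (inv_into (fibre E x) \<Phi> (axis k 1)) (inv_into (fibre E x) \<Phi> (axis l 1))"
  have "smooth_on ?O (\<lambda>p. ?h k l (frame_proj E (c p)))" for k l
  proof (rule smooth_on_cong)
    have "smooth_function A W (?h k l)"
      using E UW(2) unfolding hermitian_bundle_def by blast
    then have "smooth_on (\<phi> ` (U \<inter> W)) (?h k l \<circ> inv_into U \<phi>)"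
      using UW(1) unfolding smooth_function_def by blast
    then show "smooth_on ?O (\<lambda>p. (?h k l \<circ> inv_into U \<phi>) (\<phi> (frame_proj E (c p))))"
      by (rule smooth_on_compose[OF C(3)]) blast
  qed (simp add: inv_into_f_f[OF inj])
  then have "smooth_on ?O (\<lambda>p. \<Sum>k\<in>UNIV. \<Sum>l\<in>UNIV.
      matrix (\<Phi> \<circ> d p) $ k $ j * cnj (matrix (\<Phi> \<circ> c p) $ l $ i) * ?h k l (frame_proj E (c p)))" for i j
    by (intro smooth_on_sum smooth_on_mult smooth_on_bounded_linear[OF bounded_linear_cnj]
        smooth_on_component C(4) D(4))
  then have "smooth_on ?O (\<lambda>p. frame_trans E (c p) (d p) $ i $ j)" for i j
    by (rule smooth_on_cong)
      (rule frame_trans_in_trivialization[OF E UW(2) C(1) D(1) refl eq[symmetric], symmetric], simp)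
  then have "smooth_on ?O (\<lambda>p. frame_trans E (c p) (d p))"
    by (rule smooth_on_matrix)
  then show "\<exists>O'. open O' \<and> p0 \<in> O' \<and> smooth_on (UNIV \<inter> O') (\<lambda>p. frame_trans E (c p) (d p))"
    using C(2) UW(3,4) by (intro exI[of _ ?O]) simp
qed

text \<open>This supplies the smooth curve in the loop group that moves \<open>c s\<close> to
  \<open>d s\<close>. Smoothness is tested on adjoints, so the pointwise result is applied with the
  plane as parameter space.\<close>

lemma frame_trans_scurve:
  fixes E :: "('m, 'e, 'n::finite) vbundle" and A :: "('m, 'a::euclidean_space) charts"
  assumes "smooth_manifold X A" "hermitian_bundle X A E"
    and c: "c \<in> scurves (LFr X A E)" and d: "d \<in> scurves (LFr X A E)"
    and eq: "\<And>s. LFr_proj E (c s) = LFr_proj E (d s)"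
  shows "(\<lambda>s \<theta>. frame_trans E (c s \<theta>) (d s \<theta>)) \<in> scurves LU"
proof -
  have c': "range c \<subseteq> loops (frame_charts X A E)" "smooth_into (frame_charts X A E) (\<lambda>(s, \<theta>). c s \<theta>)"
    and d': "range d \<subseteq> loops (frame_charts X A E)" "smooth_into (frame_charts X A E) (\<lambda>(s, \<theta>). d s \<theta>)"
    using c d by (simp_all add: LFr_def scurves_loop_space)
  have eq': "frame_proj E (c s \<theta>) = frame_proj E (d s \<theta>)" for s \<theta>
    using eq[of s] unfolding LFr_proj_def by (rule fun_cong)
  have fr: "c s \<theta> \<in> frames X E" "d s \<theta> \<in> frames X E" for s \<theta>
    using smooth_into_frame_charts_frames[OF c'(2), of "(s, \<theta>)"]
      smooth_into_frame_charts_frames[OF d'(2), of "(s, \<theta>)"] by simp_all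
  have U: "frame_trans E (c s \<theta>) (d s \<theta>) \<in> unitary_matrices" for s \<theta>
    by (rule frame_trans(1)[OF fr eq'])
  have "smooth_on UNIV (\<lambda>p. frame_trans E (case p of (s, \<theta>) \<Rightarrow> c s \<theta>) (case p of (s, \<theta>) \<Rightarrow> d s \<theta>))"
    by (rule smooth_on_frame_trans[OF assms(1,2) c'(2) d'(2)]) (simp add: eq' split: prod.split)
  then have sm: "smooth_on UNIV (\<lambda>(s, \<theta>). frame_trans E (c s \<theta>) (d s \<theta>))"
    by (simp add: case_prod_beta')
  then have into: "smooth_into unitary_charts (\<lambda>(s, \<theta>). frame_trans E (c s \<theta>) (d s \<theta>))"
    using U by (auto simp: smooth_into_def unitary_charts_def comp_def vimage_def split_def)
  \<comment> \<open>Restricting the two-variable map to a line shows that each member of the family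
    is itself a loop.\<close>
  have "smooth_on UNIV (\<lambda>\<theta>::real. (s::real, \<theta>))" for s
    by (intro smooth_on_Pair smooth_on_const smooth_on_ident)
  from smooth_into_compose[OF into this]
  have "smooth_into unitary_charts (\<lambda>\<theta>. frame_trans E (c s \<theta>) (d s \<theta>))" for s
    by simp
  moreover have "c s (\<theta> + 2 * pi) = c s \<theta>" "d s (\<theta> + 2 * pi) = d s \<theta>" for s \<theta>
    using c'(1) d'(1) unfolding loops_def by blast+
  ultimately have "(\<lambda>\<theta>. frame_trans E (c s \<theta>) (d s \<theta>)) \<in> loops unitary_charts" for s
    by (simp add: loops_def)
  with into show ?thesis
    by (auto simp: LU_def scurves_loop_space)
qed

section \<open>Angles on the circle\<close>

text \<open>Angles with equal \<open>cis\<close> differ by an integer multiple of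
  \<open>2 * pi\<close>, a period of the loop. Rotation by a point of the circle can thus be
  computed with any angle for it.\<close>

lemma loop_rotate_cis_cong:
  assumes "\<gamma> \<in> loops A" "cis t = cis u"
  shows "loop_rotate t \<gamma> = loop_rotate u \<gamma>"
proof -
  have per: "\<gamma> (\<theta> + 2 * pi) = \<gamma> \<theta>" for \<theta>
    using assms(1) by (simp add: loops_def)
  have nat: "\<gamma> (\<theta> + 2 * pi * real m) = \<gamma> \<theta>" for \<theta> m
  proof (induction m)
    case (Suc m)
    then show ?case
      using per[of "\<theta> + 2 * pi * real m"] by (simp add: algebra_simps)
  qed simp
  have int: "\<gamma> (\<theta> + 2 * pi * of_int n) = \<gamma> \<theta>" for \<theta> and n :: int
  proof (cases n)
    case (nonneg m)
    then show ?thesis using nat by simp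
  next
    case (neg m)
    then have eq: "\<theta> + 2 * pi * of_int n + 2 * pi * real (Suc m) = \<theta>"
      by (simp add: distrib_left[symmetric])
    show ?thesis
      using nat[of "\<theta> + 2 * pi * of_int n" "Suc m"] unfolding eq by (rule sym)
  qed
  obtain n :: int where n: "t = u + 2 * pi * of_int n"
    using assms(2) sin_cos_eq_iff[of t u] by (auto simp: complex_eq_iff)
  show ?thesis
    by (simp add: loop_rotate_def n int flip: add.assoc)
qed

text \<open>A local inverse of \<open>cis\<close> on the circle sends \<open>z\<close> to
  \<open>t + Arg (z * cis (- t))\<close>. Turning by \<open>- t\<close> puts the base point at 1,
  away from the branch cut of \<open>Arg\<close>.\<close>

lemma cis_locally_open:
  assumes "open N" "t \<in> N"
  shows "\<exists>D. open D \<and> cis t \<in> D \<and> (\<forall>z\<in>D \<inter> sphere 0 1. \<exists>u\<in>N. cis u = z)"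
proof -
  let ?q = "\<lambda>z. z * cis (- t)"
  let ?h = "\<lambda>z. t + Arg (?q z)"
  let ?D = "?q -` (- \<real>\<^sub>\<le>\<^sub>0)"
  have D: "open ?D"
    by (intro open_vimage continuous_intros) (simp add: open_Compl)
  have "continuous_on (- \<real>\<^sub>\<le>\<^sub>0) Arg"
    by (intro continuous_at_imp_continuous_on ballI continuous_at_Arg) simp
  then have "continuous_on ?D (\<lambda>z. Arg (?q z))"
    by (rule continuous_on_compose2[OF _ continuous_on_mult[OF continuous_on_id continuous_on_const]]) blast
  then have "continuous_on ?D ?h"
    by (intro continuous_on_add continuous_on_const)
  then have "open (?D \<inter> ?h -` N)"
    by (rule continuous_open_preimage[OF _ D assms(1)])
  moreover have "cis t \<in> ?D \<inter> ?h -` N"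
    using assms(2) by (simp add: cis_mult)
  moreover have "cis (?h z) = z" if "z \<in> sphere 0 1" for z
  proof -
    have "norm (?q z) = 1"
      using that by (simp add: norm_mult)
    then have "cis (Arg (?q z)) = ?q z"
      by (subst cis_Arg) (auto simp: sgn_eq)
    then show ?thesis
      by (simp flip: cis_mult) (simp add: cis_mult)
  qed
  ultimately show ?thesis
    by (intro exI[of _ "?D \<inter> ?h -` N"]) blast
qed

lemma smooth_antiderivative:
  fixes w :: "real \<Rightarrow> real"
  assumes "smooth_on UNIV w"
  obtains F where "\<And>x. (F has_real_derivative w x) (at x)" "smooth_on UNIV F"
proof -
  have cont: "isCont w x" for x
    using smooth_on_imp_continuous_on[OF assms] by (simp add: continuous_on_eq_continuous_at)
  obtain F where "\<And>x. (F has_vector_derivative w x) (at x)"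
    using einterval_antiderivative[of "-\<infinity>" \<infinity> w] cont by auto
  then have F: "\<And>x. (F has_real_derivative w x) (at x)"
    by (simp add: has_real_derivative_iff_has_vector_derivative)
  have "ck_on (Suc k) UNIV F" for k
  proof (rule ck_on_SucI)
    show "(F has_derivative (\<lambda>v. w x * v)) (at x)" for x
      using F[of x] by (simp add: has_field_derivative_def)
    show "ck_on k UNIV (\<lambda>x. w x * v)" for v
      by (rule ck_on_bounded_linear[OF bounded_linear_mult_left open_UNIV smooth_on_openD[OF open_UNIV assms]])
  qed simp
  then have "smooth_on UNIV F"
    by (rule smooth_on_openI[OF open_UNIV ck_on_SucD])
  with F show thesis by (rule that)
qed

text \<open>The angle is an antiderivative of the angular velocity \<open>Im (cnj z * z')\<close>.\<close>

lemma smooth_angle: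
  fixes z :: "real \<Rightarrow> complex"
  assumes z: "smooth_on UNIV z" and n: "range z \<subseteq> sphere 0 1"
  obtains t where "smooth_on UNIV t" "\<And>s. cis (t s) = z s"
proof -
  have norm: "norm (z s) = 1" for s
    using n by (auto simp: image_subset_iff)
  define z' where "z' s = frechet_derivative z (at s) 1" for s
  have ck: "ck_on k UNIV z" for k
    by (rule smooth_on_openD[OF open_UNIV z])
  have "(z has_derivative (\<lambda>h. h *\<^sub>R z' s)) (at s)" for s
  proof -
    have D: "(z has_derivative frechet_derivative z (at s)) (at s)"
      by (rule ck_on_Suc_has_derivative[OF ck[of "Suc 0"] UNIV_I])
    also have "frechet_derivative z (at s) = (\<lambda>h. h *\<^sub>R z' s)"
    proof
      show "frechet_derivative z (at s) h = h *\<^sub>R z' s" for h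
        using linear_cmul[OF has_derivative_linear[OF D], of h 1] by (simp add: z'_def)
    qed
    finally show ?thesis .
  qed
  then have D: "(z has_vector_derivative z' s) (at s)" for s
    by (simp add: has_vector_derivative_def)
  define w where "w s = Im (cnj (z s) * z' s)" for s
  have "smooth_on UNIV z'"
    unfolding z'_def using ck[of "Suc _"] by (intro smooth_on_openI) simp_all
  then have "smooth_on UNIV w"
    unfolding w_def by (intro smooth_on_bounded_linear[OF bounded_linear_Im] smooth_on_mult
        smooth_on_bounded_linear[OF bounded_linear_cnj] z)
  then obtain F where F: "\<And>s. (F has_real_derivative w s) (at s)" "smooth_on UNIV F"
    by (rule smooth_antiderivative) (rule that)
  \<comment> \<open>The constant of integration gives \<open>t 0 = Arg (z 0)\<close>, so
    \<open>cis (t 0)\<close> starts at \<open>z 0\<close>.\<close>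
  define t where "t s = F s + (Arg (z 0) - F 0)" for s
  have t: "(t has_vector_derivative w s) (at s)" for s
    unfolding t_def has_real_derivative_iff_has_vector_derivative[symmetric]
    by (rule derivative_eq_intros F(1) refl)+ simp
  \<comment> \<open>Constant norm makes the velocity orthogonal to \<open>z s\<close>; as a multiple
    of \<open>z s\<close> it is then purely imaginary, which is the equation
    \<open>rot\<close>.\<close>
  have perp: "z s \<bullet> z' s = 0" for s
  proof -
    have "((\<lambda>s. z s \<bullet> z s) has_derivative (\<lambda>h. z s \<bullet> (h *\<^sub>R z' s) + (h *\<^sub>R z' s) \<bullet> z s)) (at s)"
      using D[of s] by (intro has_derivative_inner) (simp_all add: has_vector_derivative_def)
    moreover have "(\<lambda>s. z s \<bullet> z s) = (\<lambda>s. 1)"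
      using norm by (simp add: dot_square_norm)
    ultimately have "((\<lambda>s::real. 1::real) has_derivative (\<lambda>h. z s \<bullet> (h *\<^sub>R z' s) + (h *\<^sub>R z' s) \<bullet> z s)) (at s)"
      by simp
    from has_derivative_unique[OF this has_derivative_const]
    have "z s \<bullet> (1 *\<^sub>R z' s) + (1 *\<^sub>R z' s) \<bullet> z s = 0"
      by (rule fun_cong)
    then show ?thesis
      by (simp add: inner_commute)
  qed
  have rot: "z' s = z s * (\<i> * of_real (w s))" for s
  proof -
    have "cnj (z s) * z' s = \<i> * of_real (w s)"
      using perp[of s] by (simp add: complex_eq_iff inner_complex_def w_def)
    then have "z s * (cnj (z s) * z' s) = z s * (\<i> * of_real (w s))"
      by (rule arg_cong)
    moreover have "z s * cnj (z s) = 1"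
      using complex_norm_square[of "z s"] norm[of s] by simp
    ultimately show ?thesis
      by (simp add: mult.assoc[symmetric])
  qed
  \<comment> \<open>The two factors turn at the same angular speed in opposite directions, so the
    product is constant; its value at 0 is 1.\<close>
  have "((\<lambda>s. z s * cis (- t s)) has_derivative (\<lambda>h. 0)) (at s within UNIV)" for s
  proof -
    have "((\<lambda>s. z s * cis (- t s)) has_derivative
        (\<lambda>h. z s * ((- (h *\<^sub>R w s)) *\<^sub>R (\<i> * cis (- t s))) + (h *\<^sub>R z' s) * cis (- t s))) (at s)"
      using D[of s] t[of s] unfolding has_vector_derivative_def
      by (intro has_derivative_mult has_derivative_cis has_derivative_minus)
    also have "(\<lambda>h. z s * ((- (h *\<^sub>R w s)) *\<^sub>R (\<i> * cis (- t s))) + (h *\<^sub>R z' s) * cis (- t s)) = (\<lambda>h. 0)"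
      by (simp add: rot scaleR_conv_of_real algebra_simps)
    finally show ?thesis .
  qed
  then obtain c where c: "\<And>s. z s * cis (- t s) = c"
    using has_derivative_zero_constant[of UNIV "\<lambda>s. z s * cis (- t s)"] by auto
  have "cis (t 0) = z 0"
    using cis_Arg[of "z 0"] norm[of 0] by (cases "z 0 = 0") (simp_all add: t_def sgn_eq)
  then have "c = 1"
    using c[of 0] by (simp add: cis_mult flip: \<open>cis (t 0) = z 0\<close>)
  have "cis (t s) = z s" for s
  proof -
    have "z s * cis (- t s) * cis (t s) = z s"
      by (simp add: mult.assoc cis_mult)
    then show ?thesis
      by (simp add: c \<open>c = 1\<close>)
  qed
  moreover have "smooth_on UNIV t"
    unfolding t_def by (intro smooth_on_add F(2) smooth_on_const)
  ultimately show thesis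
    by (intro that[of t])
qed

section \<open>Rotation invariance of the reduced bundle\<close>

lemma smooth_embedding_point:
  assumes "smooth_embedding X Y f"
  shows "inj_on f (points X)" "p \<in> points X \<Longrightarrow> f p \<in> points Y"
    "c \<in> scurves X \<longleftrightarrow> range c \<subseteq> points X \<and> f \<circ> c \<in> scurves Y"
proof -
  have hom: "homeomorphic_map (stop X) (subtopology (stop Y) (f ` points X)) f"
    using assms by (simp add: smooth_embedding_def embedding_map_def)
  show "inj_on f (points X)"
    by (rule homeomorphic_imp_injective_map[OF hom])
  show "f p \<in> points Y" if "p \<in> points X"
    using homeomorphic_imp_surjective_map[OF hom] that by auto
  show "c \<in> scurves X \<longleftrightarrow> range c \<subseteq> points X \<and> f \<circ> c \<in> scurves Y"
    using assms by (simp add: smooth_embedding_def)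
qed

text \<open>An embedding has a continuous inverse on its image, so continuity may be tested after
  applying \<open>j\<close>. For the circle action this moves the question to loops of
  frames.\<close>

lemma continuous_map_into_embedded:
  assumes "embedding_map X Y j" "continuous_map Z Y (\<lambda>z. j (f z))" "\<And>z. z \<in> topspace Z \<Longrightarrow> f z \<in> topspace X"
  shows "continuous_map Z X f"
proof -
  obtain g where g: "homeomorphic_maps X (subtopology Y (j ` topspace X)) j g"
    using assms(1) unfolding embedding_map_def homeomorphic_map_maps by blast
  have "continuous_map Z (subtopology Y (j ` topspace X)) (\<lambda>z. j (f z))"
    using assms(2,3) by (auto simp: continuous_map_in_subtopology)
  then have "continuous_map Z X (g \<circ> (\<lambda>z. j (f z)))"
    using g by (intro continuous_map_compose) (auto simp: homeomorphic_maps_def)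
  then show ?thesis
    by (rule continuous_map_eq) (use g assms(3) in \<open>auto simp: homeomorphic_maps_def\<close>)
qed

text \<open>A smooth curve of loops is continuous for the loop topology, so its range is a connected
  set containing the unit loop.\<close>

lemma LU_curve_in_component:
  assumes "a \<in> scurves LU" "a s = LU_one"
  shows "a t \<in> points L0U"
proof -
  have "continuous_map euclideanreal (stop LU) a"
    using scurve_continuous_map[of a unitary_charts] assms(1) by (simp add: LU_def loop_space_def)
  then have "connectedin (stop LU) (range a)"
    by (rule connectedin_continuous_map_image) (simp add: connected_UNIV)
  then have "connected_component_of (stop LU) LU_one (a t)"
    unfolding connected_component_of_def using assms(2) by (metis rangeI)
  moreover have "a t \<in> points LU"
    using assms(1) by (auto simp: LU_def scurves_loop_space)
  ultimately show ?thesis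
    by (simp add: L0U_def sub_space_def)
qed

lemma const_scurve:
  assumes "\<gamma> \<in> loops A"
  shows "(\<lambda>s. \<gamma>) \<in> scurves (loop_space A)"
proof -
  have "smooth_into A \<gamma>"
    using assms by (simp add: loops_def)
  then have "smooth_into A (\<lambda>p :: real \<times> real. \<gamma> (snd p))"
    by (rule smooth_into_compose[OF _ smooth_on_snd[OF smooth_on_ident]])
  then show ?thesis
    using assms by (simp add: scurves_loop_space split_def)
qed

lemma const_scurve_L0U:
  assumes "b \<in> points L0U"
  shows "(\<lambda>s. b) \<in> scurves L0U"
  using assms const_scurve[of b unitary_charts] by (simp add: L0U_def sub_space_def LU_def)

text \<open>The adjoint of the rotated curve is the adjoint of \<open>c\<close> composed with the
  smooth shear sending \<open>(s, \<theta>)\<close> to \<open>(s, \<theta> + t s)\<close>.\<close>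

lemma rotate_scurve:
  assumes c: "c \<in> scurves (loop_space A)" and t: "smooth_on UNIV t"
  shows "(\<lambda>s. loop_rotate (t s) (c s)) \<in> scurves (loop_space A)"
proof -
  have c': "range c \<subseteq> loops A" "smooth_into A (\<lambda>(s, \<theta>). c s \<theta>)"
    using c by (simp_all add: scurves_loop_space)
  have "smooth_on UNIV (\<lambda>p :: real \<times> real. t (fst p))"
    by (rule smooth_on_compose[OF smooth_on_fst[OF smooth_on_ident] t]) simp
  then have "smooth_on UNIV (\<lambda>p :: real \<times> real. (fst p, snd p + t (fst p)))"
    by (intro smooth_on_Pair smooth_on_add smooth_on_fst smooth_on_snd smooth_on_ident)
  from smooth_into_compose[OF c'(2) this]
  show ?thesis
    using c'(1) by (auto simp: scurves_loop_space loop_rotate_def[abs_def] split_def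
        intro: loops_rotate[unfolded loop_rotate_def])
qed

lemma smooth_on_oscillation: "smooth_on UNIV (\<lambda>s::real. t + e * sin s)"
proof -
  have "smooth_on UNIV (\<lambda>s. e * sin s + 0 * cos s)"
    by (rule smooth_on_openI[OF open_UNIV ck_on_sin_cos])
  then show ?thesis
    by (intro smooth_on_add smooth_on_const) simp
qed

text \<open>Smooth curves are parametrized by the whole real line, so the rotation parameter has to
  oscillate inside the interval on which the rotated base loops stay in the trivializing set.\<close>

lemma locally_rotation_invariant:
  fixes E :: "('m, 'e, 'n::finite) vbundle" and A :: "('m, 'a::euclidean_space) charts"
    and P :: "'p smooth_space"
  assumes M: "smooth_manifold X A" and E: "hermitian_bundle X A E"
    and red: "L0_reduction X A E P pr act j" and p: "p \<in> points P"
  shows "\<exists>e>0. \<forall>t1\<in>ball t0 e. \<forall>t2\<in>ball t0 e. loop_rotate t1 (j p) \<in> j ` points P \<longrightarrow>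
    loop_rotate t2 (j p) \<in> j ` points P"
proof -
  have pb: "principal_bundle L0U LU_mult LU_one P (loop_space A) pr act"
    and emb: "smooth_embedding P (LFr X A E) j"
    and pr: "\<And>p. p \<in> points P \<Longrightarrow> pr p = LFr_proj E (j p)"
    and act: "\<And>p a. p \<in> points P \<Longrightarrow> a \<in> points L0U \<Longrightarrow> j (act p a) = LFr_act (j p) a"
    using red by (simp_all add: L0_reduction_def)
  note J = smooth_embedding_point[OF emb]
  define \<gamma> where "\<gamma> = j p"
  define x where "x = pr p"
  have \<gamma>: "\<gamma> \<in> loops (frame_charts X A E)"
    using J(2)[OF p] by (simp add: \<gamma>_def LFr_def)
  have proj_rot: "LFr_proj E (loop_rotate t \<gamma>) = loop_rotate t x" for t
    by (simp add: x_def \<gamma>_def pr[OF p] LFr_proj_def loop_rotate_def)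
  have "continuous_map (stop P) (stop (loop_space A)) pr"
    using pb by (simp add: principal_bundle_def smooth_map_def)
  then have x: "x \<in> loops A"
    using continuous_map_image_subset_topspace p by (fastforce simp: x_def)
  have loc: "\<forall>x\<in>points (loop_space A). \<exists>V \<tau>. openin (stop (loop_space A)) V \<and> x \<in> V \<and>
        diffeomorphism (sub_space P {p \<in> points P. pr p \<in> V})
          (prod_space (sub_space (loop_space A) V) L0U) (\<lambda>p. (pr p, \<tau> p)) \<and>
        (\<forall>p\<in>points P. \<forall>a\<in>points L0U. pr p \<in> V \<longrightarrow> \<tau> (act p a) = LU_mult (\<tau> p) a)"
    using pb unfolding principal_bundle_def by (elim conjE)
  have "loop_rotate t0 x \<in> points (loop_space A)"
    using loops_rotate[OF x] by simp
  from bspec[OF loc this] obtain V and \<tau> :: "'p \<Rightarrow> real \<Rightarrow> complex^'n^'n" where V: "openin (stop (loop_space A)) V" "loop_rotate t0 x \<in> V"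
    and diff: "diffeomorphism (sub_space P {p \<in> points P. pr p \<in> V})
      (prod_space (sub_space (loop_space A) V) L0U) (\<lambda>p. (pr p, \<tau> p))"
    by (elim exE conjE) (rule that)
  let ?S = "{p \<in> points P. pr p \<in> V}"
  let ?f = "\<lambda>p. (pr p, \<tau> p)"
  have pS: "points (sub_space P ?S) = ?S"
    by (auto simp: sub_space_def)
  have embf: "smooth_embedding (sub_space P ?S) (prod_space (sub_space (loop_space A) V) L0U) ?f"
    and surj: "?f ` ?S = (loops A \<inter> V) \<times> points L0U"
    using diff pS by (simp_all add: diffeomorphism_def prod_space_def sub_space_def[of "loop_space A"])
  note FE = smooth_embedding_point[OF embf, unfolded pS]
  have "continuous_map euclideanreal (prod_topology euclideanreal (loop_topology A)) (\<lambda>t. (t, x))"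
    using x by (simp add: continuous_map_pairwise comp_def)
  from continuous_map_compose[OF this continuous_map_loop_rotate]
  have "continuous_map euclideanreal (loop_topology A) (\<lambda>t. loop_rotate t x)"
    by (simp add: comp_def)
  moreover have "openin (loop_topology A) V"
    using V(1) by (simp add: loop_space_def)
  ultimately have "open {t. loop_rotate t x \<in> V}"
    using openin_continuous_map_preimage by fastforce
  then obtain e' where e': "e' > 0" "\<And>t. t \<in> ball t0 e' \<Longrightarrow> loop_rotate t x \<in> V"
    using V(2) by (auto simp: open_contains_ball subset_iff)
  \<comment> \<open>Halving keeps the closed range of \<open>t\<close>, which includes
    \<open>t0 - e\<close> and \<open>t0 + e\<close>, inside the open ball of radius
    \<open>e'\<close>.\<close>
  define e where "e = e' / 2"
  have e: "e > 0" "e < e'" using e'(1) by (simp_all add: e_def)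
  define t where "t s = t0 + e * sin s" for s
  have t: "smooth_on UNIV t"
    unfolding t_def by (rule smooth_on_oscillation)
  have tV: "loop_rotate (t s) x \<in> V" for s
  proof (rule e'(2))
    have "\<bar>e * sin s\<bar> \<le> e * 1"
      unfolding abs_mult using e(1) abs_sin_le_one[of s] by (intro mult_mono) auto
    then show "t s \<in> ball t0 e'"
      using e by (simp add: t_def dist_real_def)
  qed
  \<comment> \<open>The oscillation still reaches every parameter in the ball, at a time given by
    \<open>arcsin\<close>.\<close>
  have t_surj: "\<exists>s. t s = u" if "u \<in> ball t0 e" for u
  proof
    have "\<bar>u - t0\<bar> < e"
      using that by (simp add: dist_real_def abs_minus_commute)
    then have "- 1 \<le> (u - t0) / e" "(u - t0) / e \<le> 1"
      using e(1) by (auto simp: field_simps)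
    then show "t (arcsin ((u - t0) / e)) = u"
      using e(1) by (simp add: t_def)
  qed
  have "loop_rotate t2 (j p) \<in> j ` points P"
    if t1: "t1 \<in> ball t0 e" and t2: "t2 \<in> ball t0 e" and t1T: "loop_rotate t1 (j p) \<in> j ` points P" for t1 t2
  proof -
    obtain q where q: "q \<in> points P" "j q = loop_rotate t1 \<gamma>"
      using t1T by (auto simp: \<gamma>_def)
    obtain s1 s2 where s1: "t s1 = t1" and s2: "t s2 = t2"
      using t_surj[OF t1] t_surj[OF t2] by blast
    have prq: "pr q = loop_rotate (t s1) x"
      using pr[OF q(1)] by (simp add: q(2) proj_rot s1)
    have qS: "q \<in> ?S"
      using q(1) tV by (simp add: prq)
    have b: "\<tau> q \<in> points L0U"
      using surj qS by blast
    \<comment> \<open>In the trivialization the lift follows the rotated base loops and keeps the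
      group coordinate of \<open>q\<close>, so that it passes through \<open>q\<close> at time
      \<open>s1\<close>.\<close>
    define y where "y s = (loop_rotate (t s) x, \<tau> q)" for s
    have "y s \<in> ?f ` ?S" for s
      unfolding surj y_def using tV b loops_rotate[OF x] by simp
    then have "\<exists>c. c \<in> ?S \<and> ?f c = y s" for s
      by (metis (mono_tags, lifting) imageE)
    then obtain c where c: "\<And>s. c s \<in> ?S" "\<And>s. ?f (c s) = y s"
      by metis
    have "(\<lambda>s. loop_rotate (t s) x) \<in> scurves (loop_space A)"
      by (rule rotate_scurve[OF const_scurve[OF x] t])
    then have "y \<in> scurves (prod_space (sub_space (loop_space A) V) L0U)"
      using tV const_scurve_L0U[OF b] by (auto simp: prod_space_def sub_space_def y_def comp_def)
    moreover have "?f \<circ> c = y"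
      using c(2) by (simp add: fun_eq_iff)
    \<comment> \<open>The preimages \<open>c s\<close> were merely chosen point by point; an
      embedding reflects smooth curves, so smoothness of \<open>y\<close> passes to
      \<open>c\<close>.\<close>
    ultimately have "c \<in> scurves (sub_space P ?S)"
      unfolding FE(3) using c(1) by blast
    then have "c \<in> scurves P"
      by (simp add: sub_space_def)
    then have jc: "(\<lambda>s. j (c s)) \<in> scurves (LFr X A E)"
      using J(3)[of c] by (simp add: comp_def)
    have d: "(\<lambda>s. loop_rotate (t s) \<gamma>) \<in> scurves (LFr X A E)"
      unfolding LFr_def by (rule rotate_scurve[OF const_scurve[OF \<gamma>] t])
    have eq: "LFr_proj E (j (c s)) = LFr_proj E (loop_rotate (t s) \<gamma>)" for s
    proof -
      have "pr (c s) = loop_rotate (t s) x"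
        using c(2)[of s] by (simp add: y_def)
      then show ?thesis
        using pr[of "c s"] c(1)[of s] by (simp add: proj_rot)
    qed
    let ?a = "\<lambda>s \<theta>. frame_trans E (j (c s) \<theta>) (loop_rotate (t s) \<gamma> \<theta>)"
    have fr: "j (c s) \<theta> \<in> frames X E" "loop_rotate (t s) \<gamma> \<theta> \<in> frames X E" for s \<theta>
      using jc d smooth_into_frame_charts_frames[of X A E "\<lambda>(s, \<theta>). j (c s) \<theta>" "(s, \<theta>)"]
        smooth_into_frame_charts_frames[of X A E "\<lambda>(s, \<theta>). loop_rotate (t s) \<gamma> \<theta>" "(s, \<theta>)"]
      by (simp_all add: LFr_def scurves_loop_space)
    \<comment> \<open>At \<open>s1\<close> the lift is \<open>q\<close>, whose image is the rotated
      loop. The difference there is the unit loop, which anchors the curve in the identity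
      component.\<close>
    have "?f (c s1) = ?f q"
      unfolding c(2) y_def by (simp add: prq)
    then have "c s1 = q"
      by (rule inj_onD[OF FE(1) _ c(1) qS])
    then have "j (c s1) = loop_rotate (t s1) \<gamma>"
      by (simp add: q(2) s1)
    then have "?a s1 = LU_one"
      using frame_trans_self[OF fr(2)] by (simp add: LU_one_def)
    from LU_curve_in_component[OF frame_trans_scurve[OF M E jc d eq] this]
    have a: "?a s2 \<in> points L0U" .
    have "continuous_map (prod_topology (stop P) (stop L0U)) (stop P) (\<lambda>(p, a). act p a)"
      using pb by (simp add: principal_bundle_def smooth_map_def prod_space_def)
    then have "act (c s2) (?a s2) \<in> points P"
      using continuous_map_image_subset_topspace[of _ "stop P" "\<lambda>(p, a). act p a"] c(1)[of s2] a
      by (force simp: image_subset_iff)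
    \<comment> \<open>At \<open>s2\<close> the difference lies in the reduced structure group, so
      acting by it on the lift inside \<open>P\<close> gives a point that \<open>j\<close> sends to
      the rotated loop.\<close>
    moreover have "loop_rotate t2 \<gamma> = j (act (c s2) (?a s2))"
    proof -
      have "LFr_act (j (c s2)) (?a s2) = loop_rotate (t s2) \<gamma>"
        unfolding LFr_act_def using eq[of s2]
        by (intro ext frame_trans(2)[OF fr, THEN fun_cong]) (auto simp: LFr_proj_def fun_eq_iff)
      then show ?thesis
        using act[OF _ a] c(1)[of s2] s2 by simp
    qed
    ultimately have "loop_rotate t2 \<gamma> \<in> j ` points P"
      by (rule rev_image_eqI)
    then show ?thesis
      by (simp add: \<gamma>_def)
  qed
  with e(1) show ?thesis by blast
qed

lemma rotation_invariant:
  fixes E :: "('m, 'e, 'n::finite) vbundle" and A :: "('m, 'a::euclidean_space) charts"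
  assumes M: "smooth_manifold X A" and E: "hermitian_bundle X A E"
    and red: "L0_reduction X A E P pr act j" and p: "p \<in> points P"
  shows "loop_rotate t (j p) \<in> j ` points P"
proof -
  let ?T = "{t. loop_rotate t (j p) \<in> j ` points P}"
  \<comment> \<open>The local result holds for every ordered pair of parameters in a ball, so a
    single member of \<open>?T\<close> there forces the whole ball into \<open>?T\<close>.\<close>
  have loc: "\<exists>e>0. (\<forall>u\<in>ball t e. u \<in> ?T) \<or> (\<forall>u\<in>ball t e. u \<notin> ?T)" for t
    using locally_rotation_invariant[OF assms, of t] by blast
  have o: "open ?T"
    unfolding open_contains_ball
  proof
    fix t assume "t \<in> ?T"
    then show "\<exists>e>0. ball t e \<subseteq> ?T"
      using loc[of t] centre_in_ball by (metis subsetI)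
  qed
  have "open (- ?T)"
    unfolding open_contains_ball
  proof
    fix t assume "t \<in> - ?T"
    then show "\<exists>e>0. ball t e \<subseteq> - ?T"
      using loc[of t] centre_in_ball by (metis ComplD ComplI subsetI)
  qed
  then have "?T = {} \<or> ?T = UNIV"
    using o clopen[of ?T] unfolding closed_def by blast
  moreover have "0 \<in> ?T"
    using p by simp
  ultimately show ?thesis by blast
qed

section \<open>The circle action on the reduced bundle\<close>

theorem proposition4p12:
  fixes X :: "'m topology" and A :: "('m, 'a::euclidean_space) charts"
    and E :: "('m, 'e, 'n::finite) vbundle"
    and P :: "'p smooth_space"
    and pr :: "'p \<Rightarrow> real \<Rightarrow> 'm"
    and act :: "'p \<Rightarrow> (real \<Rightarrow> complex^'n^'n) \<Rightarrow> 'p"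
    and j :: "'p \<Rightarrow> real \<Rightarrow> complex^'n \<Rightarrow> 'e"
  assumes "smooth_manifold X A"
    and "hermitian_bundle X A E"
    and "L0_reduction X A E P pr act j"
  shows "\<exists>\<rho>. circle_action P \<rho> \<and>
    (\<forall>\<theta>\<^sub>0. \<forall>p\<in>points P. j (\<rho> (cis \<theta>\<^sub>0) p) = loop_rotate \<theta>\<^sub>0 (j p))"
proof -
  let ?L = "loop_topology (frame_charts X A E)"
  have emb: "smooth_embedding P (LFr X A E) j"
    using assms(3) by (simp add: L0_reduction_def)
  note J = smooth_embedding_point[OF emb]
  have embt: "embedding_map (stop P) ?L j"
    using emb by (simp add: smooth_embedding_def LFr_def loop_space_def)
  have jc: "continuous_map (stop P) ?L j"
    using embt unfolding embedding_map_def
    by (auto dest: homeomorphic_imp_continuous_map simp: continuous_map_in_subtopology)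
  have jl: "j p \<in> loops (frame_charts X A E)" if "p \<in> points P" for p
    using J(2)[OF that] by (simp add: LFr_def)
  \<comment> \<open>\<open>Arg\<close> selects one angle for \<open>z\<close>. Its jump is harmless
    for the algebra because \<open>j\<rho>\<close> below holds for every angle
    \<open>t\<close>.\<close>
  define \<rho> where "\<rho> z p = inv_into (points P) j (loop_rotate (Arg z) (j p))" for z p
  have j\<rho>: "j (\<rho> (cis t) p) = loop_rotate t (j p)" if "p \<in> points P" for t p
  proof -
    have "cis (Arg (cis t)) = cis t"
      by (subst cis_Arg) simp_all
    then have "loop_rotate (Arg (cis t)) (j p) = loop_rotate t (j p)"
      by (rule loop_rotate_cis_cong[OF jl[OF that]])
    then show ?thesis
      using rotation_invariant[OF assms that, of t] by (simp add: \<rho>_def f_inv_into_f)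
  qed
  have \<rho>P: "\<rho> z p \<in> points P" if "p \<in> points P" for z p
    unfolding \<rho>_def by (rule inv_into_into[OF rotation_invariant[OF assms that]])
  have circ: "\<exists>t. cis t = z" if "z \<in> sphere 0 1" for z
    using that cis_Arg[of z] by (intro exI[of _ "Arg z"], cases "z = 0") (simp_all add: sgn_eq)
  \<comment> \<open>Injectivity of \<open>j\<close> pulls the action laws back from those of
    rotation.\<close>
  have one: "\<rho> 1 p = p" if "p \<in> points P" for p
    using j\<rho>[OF that, of 0] by (intro inj_onD[OF J(1)] \<rho>P that) simp
  have mult: "\<rho> (z * w) p = \<rho> z (\<rho> w p)" if z: "z \<in> sphere 0 1" and w: "w \<in> sphere 0 1" and p: "p \<in> points P" for z w p
  proof -
    obtain t u where tu: "cis t = z" "cis u = w"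
      using circ[OF z] circ[OF w] by blast
    have "j (\<rho> (cis (t + u)) p) = j (\<rho> (cis t) (\<rho> (cis u) p))"
      by (simp add: j\<rho> \<rho>P p loop_rotate_rotate)
    then have "\<rho> (cis (t + u)) p = \<rho> (cis t) (\<rho> (cis u) p)"
      by (rule inj_onD[OF J(1)]) (intro \<rho>P p)+
    then show ?thesis
      by (simp add: tu flip: cis_mult)
  qed
  let ?C = "top_of_set (sphere (0::complex) 1)"
  \<comment> \<open>Composing with \<open>Arg\<close> would break at the branch cut. Instead,
    preimages of open sets are described by angles, where rotation is jointly continuous, and
    carried to the circle by openness of \<open>cis\<close>.\<close>
  have "continuous_map (prod_topology ?C (stop P)) ?L (\<lambda>q. j (case q of (z, p) \<Rightarrow> \<rho> z p))"
    unfolding continuous_map_def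
  proof (intro conjI allI impI)
    show "(\<lambda>q. j (case q of (z, p) \<Rightarrow> \<rho> z p)) \<in> topspace (prod_topology ?C (stop P)) \<rightarrow> topspace ?L"
      by (auto intro: jl \<rho>P)
    fix W assume W: "openin ?L W"
    have "continuous_map (prod_topology euclideanreal (stop P)) (prod_topology euclideanreal ?L) (\<lambda>(t, p). (t, j p))"
      using jc by (simp add: continuous_map_prod_top)
    from continuous_map_compose[OF this continuous_map_loop_rotate]
    have "continuous_map (prod_topology euclideanreal (stop P)) ?L (\<lambda>(t, p). loop_rotate t (j p))"
      by (simp add: comp_def split_def)
    from openin_continuous_map_preimage[OF this W]
    have G: "openin (prod_topology euclideanreal (stop P)) {q. snd q \<in> points P \<and> loop_rotate (fst q) (j (snd q)) \<in> W}"
      by (simp add: split_def mem_Times_iff)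
    show "openin (prod_topology ?C (stop P)) {q \<in> topspace (prod_topology ?C (stop P)). j (case q of (z, p) \<Rightarrow> \<rho> z p) \<in> W}"
      (is "openin ?T ?Q")
    proof (subst openin_subopen, intro ballI)
      fix q assume "q \<in> ?Q"
      then obtain z p where q: "q = (z, p)" "z \<in> sphere 0 1" "p \<in> points P" "j (\<rho> z p) \<in> W"
        by auto
      obtain t where t: "cis t = z"
        using circ q(2) by blast
      have "(t, p) \<in> {q. snd q \<in> points P \<and> loop_rotate (fst q) (j (snd q)) \<in> W}"
        using q(3,4) by (simp add: j\<rho> flip: t)
      from G[unfolded openin_prod_topology_alt, rule_format, OF this]
      obtain N O' where "openin euclideanreal N" and N: "openin (stop P) O'" "t \<in> N" "p \<in> O'"
        and sub: "N \<times> O' \<subseteq> {q. snd q \<in> points P \<and> loop_rotate (fst q) (j (snd q)) \<in> W}"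
        by (elim exE conjE) (rule that)
      then have "open N"
        by simp
      obtain D where D: "open D" "cis t \<in> D" "\<And>z. z \<in> D \<inter> sphere 0 1 \<Longrightarrow> \<exists>u\<in>N. cis u = z"
        using cis_locally_open[OF \<open>open N\<close> N(2)] by blast
      have "openin ?T ((sphere 0 1 \<inter> D) \<times> O')"
        using N(1) D(1) by (simp add: openin_prod_Times_iff openin_open_Int)
      moreover have "q \<in> (sphere 0 1 \<inter> D) \<times> O'"
        using q D(2) t N(3) by simp
      moreover have "(sphere 0 1 \<inter> D) \<times> O' \<subseteq> ?Q"
      proof
        fix r assume "r \<in> (sphere 0 1 \<inter> D) \<times> O'"
        then obtain z' p' where r: "r = (z', p')" "z' \<in> sphere 0 1" "z' \<in> D" "p' \<in> O'"
          by blast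
        then obtain u where u: "u \<in> N" "cis u = z'"
          using D(3) by blast
        have "p' \<in> points P" "loop_rotate u (j p') \<in> W"
          using subsetD[OF sub, of "(u, p')"] u(1) r(4) by simp_all
        then show "r \<in> ?Q"
          using r(1,2) by (simp add: j\<rho> flip: u(2))
      qed
      ultimately show "\<exists>T. openin ?T T \<and> q \<in> T \<and> T \<subseteq> ?Q"
        by blast
    qed
  qed
  then have cont: "continuous_map (prod_topology ?C (stop P)) (stop P) (\<lambda>(z, p). \<rho> z p)"
    by (rule continuous_map_into_embedded[OF embt]) (auto intro: \<rho>P)
  have curves: "(\<lambda>(z, p). \<rho> z p) \<circ> c \<in> scurves P" if "c \<in> scurves (prod_space circle P)" for c
  proof -
    have c: "range (fst \<circ> c) \<subseteq> sphere 0 1" "smooth_on UNIV (fst \<circ> c)" "snd \<circ> c \<in> scurves P"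
      using that by (simp_all add: prod_space_def circle_def)
    \<comment> \<open>Smoothness along a curve needs an angle that varies smoothly, also where the
      curve crosses the branch cut of \<open>Arg\<close>.\<close>
    obtain t where t: "smooth_on UNIV t" "\<And>s. cis (t s) = (fst \<circ> c) s"
      using smooth_angle[OF c(2,1)] by blast
    have cP: "snd (c s) \<in> points P" for s
      using c(3) J(3)[of "snd \<circ> c"] by auto
    have "(\<lambda>s. loop_rotate (t s) ((j \<circ> (snd \<circ> c)) s)) \<in> scurves (LFr X A E)"
      using rotate_scurve[OF _ t(1)] c(3) J(3)[of "snd \<circ> c"] unfolding LFr_def by blast
    also have "(\<lambda>s. loop_rotate (t s) ((j \<circ> (snd \<circ> c)) s)) = j \<circ> ((\<lambda>(z, p). \<rho> z p) \<circ> c)"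
    proof
      fix s
      have "j (\<rho> (cis (t s)) (snd (c s))) = loop_rotate (t s) (j (snd (c s)))"
        by (rule j\<rho>[OF cP])
      then show "loop_rotate (t s) ((j \<circ> (snd \<circ> c)) s) = (j \<circ> ((\<lambda>(z, p). \<rho> z p) \<circ> c)) s"
        by (simp add: t(2) split_def)
    qed
    finally have "j \<circ> ((\<lambda>(z, p). \<rho> z p) \<circ> c) \<in> scurves (LFr X A E)" .
    moreover have "range ((\<lambda>(z, p). \<rho> z p) \<circ> c) \<subseteq> points P"
      using \<rho>P[OF cP] by (auto simp: split_def)
    ultimately show ?thesis
      by (intro J(3)[THEN iffD2] conjI)
  qed
  have "circle_action P \<rho>"
    unfolding circle_action_def smooth_map_def
    using cont curves one mult by (simp add: prod_space_def circle_def)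
  then show ?thesis
    using j\<rho> by blast
qed

end
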